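(* Let $\Gamma_1,\Gamma_2,\Gamma_3$ be nonzero real numbers with $\Gamma_1+\Gamma_2+\Gamma_3>0$, and suppose $\Gamma_i-\Gamma_j-\Gamma_k\neq0$ and $\Gamma_i\pm\Gamma_j\neq0$ for all distinct $i,j,k\in\{1,2,3\}$. Let $M=\mathbb{CP}^2\times\mathbb{CP}^2\times\mathbb{CP}^2$ carry the weighted symplectic form $\Gamma_1\omega_{FS}\oplus\Gamma_2\omega_{FS}\oplus\Gamma_3\omega_{FS}$ and the diagonal action of $SU(3)$. Then the momentum polytopes $\Delta(M)$ fall into eight different types A–H. Explicitly, $\Delta(M)$ depends only on the unordered triple of weights; label them so that $\Gamma_1>\Gamma_2>\Gamma_3$, and let $s$, $[x_1,x_2,x_3]$, $a,b,c_1,c_2,c_3$ be as in the context. Then exactly one of the following eight cases holds, and $\Delta(M)$ is the convex polygon whose vertices, in cyclic order, are those listed, with the remaining points $c_j$ lying in the relative interiors of the indicated edges: A. $\Gamma_3>0$, $\Gamma_1<\Gamma_2+\Gamma_3$: vertices $a$, $[\tfrac s2,\tfrac s2,0]$, $[\Gamma_1,\Gamma_1,\Gamma_2+\Gamma_3-\Gamma_1]$, $b$, $[\Gamma_1+\Gamma_2-\Gamma_3,\Gamma_3,\Gamma_3]$; the points $c_3,c_2,c_1$ lie (in this order from $a$) on the edge from $a$ to $[\tfrac s2,\tfrac s2,0]$. B. $\Gamma_3>0$, $\Gamma_1>\Gamma_2+\Gamma_3$: vertices $a$, $c_1$, $b$, $[\Gamma_1+\Gamma_2-\Gamma_3,\Gamma_3,\Gamma_3]$;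 $c_3,c_2$ lie (in this order from $a$) on the edge from $a$ to $c_1$. C. $\Gamma_3<0<\Gamma_2$, $\Gamma_2<\Gamma_1+\Gamma_3$, $\Gamma_2+\Gamma_3>0$: vertices $a$, $c_3$, $b$, $c_2$; $c_1$ lies on the edge from $a$ to $c_2$. D. $\Gamma_3<\Gamma_2<0$: vertices $a$, $c_1$, $b$, $[\Gamma_1-\Gamma_2+\Gamma_3,\Gamma_2,\Gamma_2]$; $c_2,c_3$ lie (in this order from $a$) on the edge from $a$ to $c_1$. E. $\Gamma_3<0<\Gamma_2$, $\Gamma_2<\Gamma_1+\Gamma_3$, $\Gamma_2+\Gamma_3<0$: vertices $a$, $c_3$, $b$, $c_2$; $c_1$ lies on the edge from $a$ to $c_3$. F. $\Gamma_3<0<\Gamma_2$, $\Gamma_2>\Gamma_1+\Gamma_3>0$, $\Gamma_2+\Gamma_3<0$: vertices $a$, $c_3$, $b$, $[\Gamma_2,\Gamma_2,\Gamma_1-\Gamma_2+\Gamma_3]$, $[\tfrac s2,\tfrac s2,0]$; $c_1$ lies on the edge from $a$ to $c_3$, and $c_2$ on the edge from $a$ to $[\tfrac s2,\tfrac s2,0]$. G. $\Gamma_3<0<\Gamma_2$, $\Gamma_1+\Gamma_3<0$: vertices $a$, $c_3$, $b$, $[\Gamma_2,\Gamma_2,\Gamma_1-\Gamma_2+\Gamma_3]$, $[\tfrac s2,\tfrac s2,0]$; $c_2,c_1$ lie (in this order from $a$) on the edge from $a$ to $c_3$. H. $\Gamma_3<0<\Gamma_2$, $\Gamma_2>\Gamma_1+\Gamma_3$,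 $\Gamma_2+\Gamma_3>0$: vertices $a$, $c_3$, $b$, $[\Gamma_2,\Gamma_2,\Gamma_1-\Gamma_2+\Gamma_3]$, $[\tfrac s2,\tfrac s2,0]$; $c_1,c_2$ lie (in this order from $a$) on the edge from $a$ to $[\tfrac s2,\tfrac s2,0]$.
   Context: $\omega_{FS}$ is the Fubini–Study symplectic form on $\mathbb{CP}^2$, obtained by reduction of the unit sphere $S^5\subset\mathbb{C}^3$ by $U(1)$. $SU(3)$ acts on $\mathbb{CP}^2$ by $A[v]=[Av]$ and diagonally on products. The dual $\mathfrak{su}(3)^*$ is identified with the trace-zero Hermitian $3\times3$ matrices via the pairing $\langle\mu,\xi\rangle=\operatorname{Im}\operatorname{tr}(\mu\xi)$ with skew-Hermitian $\xi\in\mathfrak{su}(3)$; the coadjoint action is conjugation. The momentum map is $$J(Z_1,Z_2,Z_3)=\sum_{j=1}^3\Gamma_j\,Z_j\otimes\overline{Z}_j-\tfrac13\Big(\sum_{j=1}^3\Gamma_j\Big)I_3,$$ where points of $\mathbb{CP}^2$ are represented by unit vectors and $Z\otimes\overline Z=(z_i\bar z_j)$. The dual $\mathfrak{t}^*$ of the Cartan subalgebra of diagonal matrices is identified with $\{\lambda\in\mathbb{R}^3:\lambda_1+\lambda_2+\lambda_3=0\}$, the positive Weyl chamber is $\mathfrak{t}^*_+=\{\lambda_1\ge\lambda_2\ge\lambda_3\}$, and the momentum polytope is $\Delta(M)=J(M)\cap\mathfrak{t}^*_+$, equivalently the set of ordered spectra $\lambda_1\ge\lambda_2\ge\lambda_3$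 of the matrices in $J(M)$. Notation: $s=\Gamma_1+\Gamma_2+\Gamma_3$ and, for $x_1+x_2+x_3=s$, $[x_1,x_2,x_3]=(x_1-\tfrac s3,x_2-\tfrac s3,x_3-\tfrac s3)$. With $e_1=[1:0:0]$, $e_2=[0:1:0]$, $e_3=[0:0:1]$, the points $a,b,c_1,c_2,c_3\in\mathfrak{t}^*_+$ are the spectra, arranged in decreasing order, of $J(e_1,e_1,e_1)$, $J(e_1,e_2,e_3)$, $J(e_2,e_1,e_1)$, $J(e_1,e_2,e_1)$, $J(e_1,e_1,e_2)$ respectively. That is, $a=[s,0,0]$; $b=[\Gamma_1,\Gamma_2,\Gamma_3]$ (for $\Gamma_1>\Gamma_2>\Gamma_3$); and $c_i$ is obtained by putting the three numbers $\Gamma_i,\ \Gamma_j+\Gamma_k,\ 0$ (where $\{i,j,k\}=\{1,2,3\}$) in decreasing order inside the brackets $[\cdot,\cdot,\cdot]$. The "type" of a polytope (not formally defined in the paper) refers to its combinatorics, including the positions of these points, together with its geometry in the Weyl chamber; it is the data recorded in each item of the list. *)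

theory Defs
  imports "HOL-Analysis.Analysis"
begin

section \<open>The complex projective plane and the momentum map\<close>

text \<open>\<open>\<complex>\<P>\<^sup>2\<close> is the quotient of the unit sphere \<open>S\<^sup>5\<close> in \<open>\<complex>\<^sup>3\<close> by \<open>U(1)\<close>.\<close>

definition phase_equiv :: "complex^3 \<Rightarrow> complex^3 \<Rightarrow> bool" where
  "phase_equiv z w \<longleftrightarrow> norm z = 1 \<and> norm w = 1 \<and> (\<exists>c. cmod c = 1 \<and> w = c *s z)"

lemma norm_vec_smult: "norm (c *s z) = cmod c * norm z" for z :: "complex^'n"
  by (simp add: norm_vec_def norm_mult L2_set_right_distrib)

lemma part_equivp_phase_equiv: "part_equivp phase_equiv"
proof (rule part_equivpI)
  show "\<exists>z. phase_equiv z z"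
    by (rule exI[of _ "axis 1 1"]) (auto simp: phase_equiv_def norm_axis_1 intro: exI[of _ 1])
  show "symp phase_equiv"
  proof (rule sympI)
    fix z w assume "phase_equiv z w"
    then obtain c where c: "norm z = 1" "norm w = 1" "cmod c = 1" "w = c *s z"
      by (auto simp: phase_equiv_def)
    then have "z = inverse c *s w" by (auto simp: vector_smult_assoc field_simps)
    with c show "phase_equiv w z"
      unfolding phase_equiv_def by (metis norm_inverse inverse_1)
  qed
  show "transp phase_equiv"
  proof (rule transpI)
    fix u v w assume "phase_equiv u v" "phase_equiv v w"
    then obtain c d where "norm u = 1" "norm w = 1" "cmod c = 1" "cmod d = 1"
        "w = (d * c) *s u"
      by (auto simp: phase_equiv_def vector_smult_assoc)
    then show "phase_equiv u w"
      unfolding phase_equiv_def by (metis norm_mult mult_1)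
  qed
qed

quotient_type cp2 = "complex^3" / partial: phase_equiv
  by (rule part_equivp_phase_equiv)

definition outer :: "complex^3 \<Rightarrow> complex^3^3" where
  "outer z = (\<chi> i j. z $ i * cnj (z $ j))"

lift_definition cp2_outer :: "cp2 \<Rightarrow> complex^3^3" is outer
proof -
  fix z w assume "phase_equiv z w"
  then obtain c where c: "cmod c = 1" "w = c *s z" by (auto simp: phase_equiv_def)
  have "c * cnj c = 1" using c by (simp add: complex_norm_square[symmetric])
  then have "c * x * (cnj c * y) = x * y" for x y
    by (metis mult.assoc mult.commute mult_1)
  then show "outer z = outer w" using c by (simp add: outer_def vec_eq_iff)
qed

text \<open>A point of \<open>\<complex>\<P>\<^sup>2 \<times> \<complex>\<P>\<^sup>2 \<times> \<complex>\<P>\<^sup>2\<close> is a triple \<open>p :: cp2^3\<close>, and the weights are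
  \<open>\<Gamma> :: real^3\<close>.\<close>

definition total_weight :: "real^3 \<Rightarrow> real" where
  "total_weight \<Gamma> = (\<Sum>j\<in>UNIV. \<Gamma> $ j)"

definition momentum_map :: "real^3 \<Rightarrow> cp2^3 \<Rightarrow> complex^3^3" where
  "momentum_map \<Gamma> p =
     (\<Sum>j\<in>UNIV. \<Gamma> $ j *\<^sub>R cp2_outer (p $ j)) - (total_weight \<Gamma> / 3) *\<^sub>R mat 1"

text \<open>With the invariant form \<open>fs_form\<close> on \<open>\<complex>\<^sup>3\<close>, whose restriction to \<open>S\<^sup>5\<close> descends to
  \<open>\<complex>\<P>\<^sup>2\<close>, and the pairing \<open>Im tr(\<mu>\<xi>)\<close>, the next three lemmas state that \<open>momentum_map\<close> is
  the equivariant momentum map of the diagonal \<open>SU(3)\<close> action for the weighted form.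
  The scale of \<open>fs_form\<close> and the sign convention \<open>d\<langle>J,\<xi>\<rangle>(V) = \<omega>(V, \<xi>\<^sub>M)\<close> are the ones that
  match this \<open>J\<close>.\<close>

definition fs_form :: "complex^3 \<Rightarrow> complex^3 \<Rightarrow> real" where
  "fs_form u v = 2 * Im (\<Sum>i\<in>UNIV. cnj (u $ i) * v $ i)"

definition momentum_lift :: "real^3 \<Rightarrow> complex^3^3 \<Rightarrow> complex^3^3" where
  "momentum_lift \<Gamma> Z =
     (\<Sum>j\<in>UNIV. \<Gamma> $ j *\<^sub>R outer (Z $ j)) - (total_weight \<Gamma> / 3) *\<^sub>R mat 1"

lemma momentum_map_lift:
  assumes "\<And>j. norm (Z $ j) = 1"
  shows "momentum_map \<Gamma> (\<chi> j. abs_cp2 (Z $ j)) = momentum_lift \<Gamma> Z"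
proof -
  have "phase_equiv (Z $ j) (Z $ j)" for j
    using assms by (auto simp: phase_equiv_def intro: exI[of _ 1])
  then have "cp2_outer (abs_cp2 (Z $ j)) = outer (Z $ j)" for j
    by (rule cp2_outer.abs_eq)
  then show ?thesis by (simp add: momentum_map_def momentum_lift_def)
qed

lemma momentum_lift_hamiltonian:
  assumes skew: "\<And>i j. \<xi> $ i $ j = - cnj (\<xi> $ j $ i)" and tr: "trace \<xi> = 0"
  shows "((\<lambda>Z. Im (trace (momentum_lift \<Gamma> Z ** \<xi>))) has_derivative
          (\<lambda>V. \<Sum>j\<in>UNIV. \<Gamma> $ j * fs_form (V $ j) (\<xi> *v (Z $ j)))) (at Z)"
proof -
  define h :: "complex^3 \<Rightarrow> complex^3 \<Rightarrow> real"
    where "h u v = Im (\<Sum>i\<in>UNIV. \<Sum>k\<in>UNIV. cnj (u $ i) * \<xi> $ i $ k * v $ k)" for u v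
  have h_alt: "h u v = Im (\<Sum>i\<in>UNIV. cnj (u $ i) * (\<xi> *v v) $ i)" for u v
    by (simp add: h_def matrix_vector_mult_def sum_distrib_left mult.assoc)
  have h_sym: "h u v = h v u" for u v
  proof -
    have "(\<Sum>i\<in>UNIV. \<Sum>k\<in>UNIV. cnj (u $ i) * \<xi> $ i $ k * v $ k) =
          (\<Sum>i\<in>UNIV. \<Sum>k\<in>UNIV. - cnj (cnj (v $ k) * \<xi> $ k $ i * u $ i))"
      by (intro sum.cong refl) (subst skew, simp)
    also have "\<dots> = - cnj (\<Sum>k\<in>UNIV. \<Sum>i\<in>UNIV. cnj (v $ k) * \<xi> $ k $ i * u $ i)"
      by (subst sum.swap) (simp add: sum_negf)
    finally show ?thesis
      unfolding h_def by (simp only: uminus_complex.sel cnj.sel minus_minus)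
  qed
  have fs: "fs_form u (\<xi> *v v) = 2 * h u v" for u v
    by (simp add: fs_form_def h_alt)
  have ev: "Im (trace (momentum_lift \<Gamma> Z ** \<xi>)) = (\<Sum>j\<in>UNIV. \<Gamma> $ j * h (Z $ j) (Z $ j))" for Z
  proof -
    have "Im (trace (momentum_lift \<Gamma> Z ** \<xi>)) =
        (\<Sum>j\<in>UNIV. \<Gamma> $ j * h (Z $ j) (Z $ j)) - total_weight \<Gamma> / 3 * Im (trace \<xi>)"
      by (simp add: momentum_lift_def trace_def matrix_matrix_mult_def outer_def h_def mat_def
            sum_3 algebra_simps)
    then show ?thesis by (simp add: tr)
  qed
  have bl: "bounded_bilinear h"
    unfolding h_def bilinear_conv_bounded_bilinear[symmetric] bilinear_def
    by (auto intro!: linearI simp: sum_3 algebra_simps)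
  have dh: "((\<lambda>Z. h (Z $ j) (Z $ j)) has_derivative (\<lambda>V. 2 * h (V $ j) (Z $ j))) (at Z)"
    for j and Z :: "complex^3^3"
  proof -
    have l: "((\<lambda>Z. Z $ j) has_derivative (\<lambda>V. V $ j)) (at Z)"
      by (rule bounded_linear_imp_has_derivative) (rule bounded_linear_vec_nth)
    show ?thesis
      using bounded_bilinear.FDERIV[OF bl l l] by (simp add: h_sym[of "Z $ j"])
  qed
  show ?thesis
    unfolding ev fs by (intro has_derivative_sum has_derivative_mult_right dh)
qed

lemma momentum_lift_equivariant:
  assumes "A ** (\<chi> i j. cnj (A $ j $ i)) = mat 1"
  shows "momentum_lift \<Gamma> (\<chi> j. A *v (Z $ j)) =
         A ** momentum_lift \<Gamma> Z ** (\<chi> i j. cnj (A $ j $ i))"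
proof -
  let ?B = "\<chi> i j. cnj (A $ j $ i)"
  have o: "outer (A *v z) = A ** outer z ** ?B" for z
    by (simp add: vec_eq_iff outer_def matrix_vector_mult_def matrix_matrix_mult_def sum_3
          algebra_simps)
  have sc: "A ** (c *\<^sub>R X) ** ?B = c *\<^sub>R (A ** X ** ?B)" for c X
    by (simp add: vec_eq_iff matrix_matrix_mult_def sum_3 algebra_simps)
  have add: "A ** (X + Y) ** ?B = A ** X ** ?B + A ** Y ** ?B"
    and sub: "A ** (X - Y) ** ?B = A ** X ** ?B - A ** Y ** ?B" for X Y
    by (simp_all add: vec_eq_iff matrix_matrix_mult_def sum_3 algebra_simps)
  have "A ** momentum_lift \<Gamma> Z ** ?B =
        (\<Sum>j\<in>UNIV. \<Gamma> $ j *\<^sub>R (A ** outer (Z $ j) ** ?B)) - (total_weight \<Gamma> / 3) *\<^sub>R (A ** mat 1 ** ?B)"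
    by (simp only: momentum_lift_def sum_3 add sub sc)
  also have "A ** mat 1 ** ?B = mat 1" using assms by simp
  finally show ?thesis by (simp add: momentum_lift_def o)
qed

definition weyl_chamber :: "(real^3) set" where
  "weyl_chamber = {x. x $ 1 + x $ 2 + x $ 3 = 0 \<and> x $ 1 \<ge> x $ 2 \<and> x $ 2 \<ge> x $ 3}"

definition diag_matrix :: "real^3 \<Rightarrow> complex^3^3" where
  "diag_matrix x = (\<chi> i j. if i = j then of_real (x $ i) else 0)"

text \<open>The intersection \<open>J(M) \<inter> \<tt>\<^sup>*\<^sub>+\<close>, where a vector in \<open>\<tt>\<^sup>*\<close> stands for the
  corresponding diagonal matrix.\<close>

definition momentum_polytope :: "real^3 \<Rightarrow> (real^3) set" where
  "momentum_polytope \<Gamma> = {x \<in> weyl_chamber. diag_matrix x \<in> range (momentum_map \<Gamma>)}"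


section \<open>The marked points\<close>

definition bracket :: "real^3 \<Rightarrow> real \<Rightarrow> real \<Rightarrow> real \<Rightarrow> real^3" where
  "bracket \<Gamma> x y z =
     (let s = total_weight \<Gamma> in vector [x - s / 3, y - s / 3, z - s / 3])"

definition pt_a :: "real^3 \<Rightarrow> real^3" where
  "pt_a \<Gamma> = bracket \<Gamma> (total_weight \<Gamma>) 0 0"

definition pt_b :: "real^3 \<Rightarrow> real^3" where
  "pt_b \<Gamma> = bracket \<Gamma> (\<Gamma> $ 1) (\<Gamma> $ 2) (\<Gamma> $ 3)"

text \<open>The numbers \<open>\<Gamma>\<^sub>i\<close>, \<open>\<Gamma>\<^sub>j + \<Gamma>\<^sub>k\<close> and \<open>0\<close> with \<open>{i, j, k} = {1, 2, 3}\<close>,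
  in decreasing order.\<close>

definition pt_c :: "real^3 \<Rightarrow> 3 \<Rightarrow> real^3" where
  "pt_c \<Gamma> i =
     (let l = rev (sort [\<Gamma> $ i, \<Sum>j\<in>-{i}. \<Gamma> $ j, 0]) in bracket \<Gamma> (l ! 0) (l ! 1) (l ! 2))"


lemma
  shows momentum_lift_a:
      "momentum_lift \<Gamma> (vector [axis 1 1, axis 1 1, axis 1 1]) = diag_matrix (pt_a \<Gamma>)"
    and momentum_lift_b:
      "momentum_lift \<Gamma> (vector [axis 1 1, axis 2 1, axis 3 1]) = diag_matrix (pt_b \<Gamma>)"
    and momentum_lift_c1: "momentum_lift \<Gamma> (vector [axis 2 1, axis 1 1, axis 1 1]) =
      diag_matrix (bracket \<Gamma> (\<Gamma> $ 2 + \<Gamma> $ 3) (\<Gamma> $ 1) 0)"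
    and momentum_lift_c2: "momentum_lift \<Gamma> (vector [axis 1 1, axis 2 1, axis 1 1]) =
      diag_matrix (bracket \<Gamma> (\<Gamma> $ 1 + \<Gamma> $ 3) (\<Gamma> $ 2) 0)"
    and momentum_lift_c3: "momentum_lift \<Gamma> (vector [axis 1 1, axis 1 1, axis 2 1]) =
      diag_matrix (bracket \<Gamma> (\<Gamma> $ 1 + \<Gamma> $ 2) (\<Gamma> $ 3) 0)"
  by (simp_all add: vec_eq_iff forall_3 sum_3 momentum_lift_def outer_def diag_matrix_def mat_def
        bracket_def pt_a_def pt_b_def total_weight_def axis_def Let_def complex_eq_iff)


section \<open>Convex polygons\<close>

definition convex_polygon :: "(real^3) list \<Rightarrow> (real^3) set \<Rightarrow> bool" where
  "convex_polygon vs P \<longleftrightarrow>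
     distinct vs \<and> aff_dim P = 2 \<and> P = convex hull (set vs) \<and>
     {v. v extreme_point_of P} = set vs \<and>
     {e. e edge_of P} =
       {closed_segment (vs ! i) (vs ! (Suc i mod length vs)) | i. i < length vs}"

text \<open>The points of the list lie, in this order from \<open>u\<close>, in the open segment from \<open>u\<close> to \<open>v\<close>.\<close>

fun ordered_in_segment :: "real^3 \<Rightarrow> (real^3) list \<Rightarrow> real^3 \<Rightarrow> bool" where
  "ordered_in_segment u [] v = True"
| "ordered_in_segment u (x # xs) v = (x \<in> open_segment u v \<and> ordered_in_segment x xs v)"


section \<open>The eight types\<close>

definition admissible :: "real^3 \<Rightarrow> bool" where
  "admissible \<Gamma> \<longleftrightarrow>
     (\<forall>i. \<Gamma> $ i \<noteq> 0) \<and> total_weight \<Gamma> > 0 \<and>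
     (\<forall>i j k. distinct [i, j, k] \<longrightarrow> \<Gamma> $ i - \<Gamma> $ j - \<Gamma> $ k \<noteq> 0) \<and>
     (\<forall>i j. i \<noteq> j \<longrightarrow> \<Gamma> $ i + \<Gamma> $ j \<noteq> 0 \<and> \<Gamma> $ i - \<Gamma> $ j \<noteq> 0)"

definition relabel :: "(3 \<Rightarrow> 3) \<Rightarrow> real^3 \<Rightarrow> real^3" where
  "relabel \<sigma> \<Gamma> = (\<chi> j. \<Gamma> $ \<sigma> j)"

definition decreasing :: "real^3 \<Rightarrow> bool" where
  "decreasing \<Gamma> \<longleftrightarrow> \<Gamma> $ 1 > \<Gamma> $ 2 \<and> \<Gamma> $ 2 > \<Gamma> $ 3"

datatype polytope_type =
  Type_A | Type_B | Type_C | Type_D | Type_E | Type_F | Type_G | Type_H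

fun type_weights :: "polytope_type \<Rightarrow> real^3 \<Rightarrow> bool" where
  "type_weights Type_A \<Gamma> \<longleftrightarrow> \<Gamma> $ 3 > 0 \<and> \<Gamma> $ 1 < \<Gamma> $ 2 + \<Gamma> $ 3"
| "type_weights Type_B \<Gamma> \<longleftrightarrow> \<Gamma> $ 3 > 0 \<and> \<Gamma> $ 1 > \<Gamma> $ 2 + \<Gamma> $ 3"
| "type_weights Type_C \<Gamma> \<longleftrightarrow> \<Gamma> $ 3 < 0 \<and> 0 < \<Gamma> $ 2 \<and> \<Gamma> $ 2 < \<Gamma> $ 1 + \<Gamma> $ 3 \<and> \<Gamma> $ 2 + \<Gamma> $ 3 > 0"
| "type_weights Type_D \<Gamma> \<longleftrightarrow> \<Gamma> $ 3 < \<Gamma> $ 2 \<and> \<Gamma> $ 2 < 0"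
| "type_weights Type_E \<Gamma> \<longleftrightarrow> \<Gamma> $ 3 < 0 \<and> 0 < \<Gamma> $ 2 \<and> \<Gamma> $ 2 < \<Gamma> $ 1 + \<Gamma> $ 3 \<and> \<Gamma> $ 2 + \<Gamma> $ 3 < 0"
| "type_weights Type_F \<Gamma> \<longleftrightarrow>
     \<Gamma> $ 3 < 0 \<and> 0 < \<Gamma> $ 2 \<and> \<Gamma> $ 2 > \<Gamma> $ 1 + \<Gamma> $ 3 \<and> \<Gamma> $ 1 + \<Gamma> $ 3 > 0 \<and> \<Gamma> $ 2 + \<Gamma> $ 3 < 0"
| "type_weights Type_G \<Gamma> \<longleftrightarrow> \<Gamma> $ 3 < 0 \<and> 0 < \<Gamma> $ 2 \<and> \<Gamma> $ 1 + \<Gamma> $ 3 < 0"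
| "type_weights Type_H \<Gamma> \<longleftrightarrow> \<Gamma> $ 3 < 0 \<and> 0 < \<Gamma> $ 2 \<and> \<Gamma> $ 2 > \<Gamma> $ 1 + \<Gamma> $ 3 \<and> \<Gamma> $ 2 + \<Gamma> $ 3 > 0"

definition pt_half :: "real^3 \<Rightarrow> real^3" where
  "pt_half \<Gamma> = bracket \<Gamma> (total_weight \<Gamma> / 2) (total_weight \<Gamma> / 2) 0"

fun type_vertices :: "polytope_type \<Rightarrow> real^3 \<Rightarrow> (real^3) list" where
  "type_vertices Type_A \<Gamma> =
     [pt_a \<Gamma>, pt_half \<Gamma>, bracket \<Gamma> (\<Gamma> $ 1) (\<Gamma> $ 1) (\<Gamma> $ 2 + \<Gamma> $ 3 - \<Gamma> $ 1), pt_b \<Gamma>,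
      bracket \<Gamma> (\<Gamma> $ 1 + \<Gamma> $ 2 - \<Gamma> $ 3) (\<Gamma> $ 3) (\<Gamma> $ 3)]"
| "type_vertices Type_B \<Gamma> =
     [pt_a \<Gamma>, pt_c \<Gamma> 1, pt_b \<Gamma>, bracket \<Gamma> (\<Gamma> $ 1 + \<Gamma> $ 2 - \<Gamma> $ 3) (\<Gamma> $ 3) (\<Gamma> $ 3)]"
| "type_vertices Type_C \<Gamma> = [pt_a \<Gamma>, pt_c \<Gamma> 3, pt_b \<Gamma>, pt_c \<Gamma> 2]"
| "type_vertices Type_D \<Gamma> =
     [pt_a \<Gamma>, pt_c \<Gamma> 1, pt_b \<Gamma>, bracket \<Gamma> (\<Gamma> $ 1 - \<Gamma> $ 2 + \<Gamma> $ 3) (\<Gamma> $ 2) (\<Gamma> $ 2)]"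
| "type_vertices Type_E \<Gamma> = [pt_a \<Gamma>, pt_c \<Gamma> 3, pt_b \<Gamma>, pt_c \<Gamma> 2]"
| "type_vertices Type_F \<Gamma> =
     [pt_a \<Gamma>, pt_c \<Gamma> 3, pt_b \<Gamma>, bracket \<Gamma> (\<Gamma> $ 2) (\<Gamma> $ 2) (\<Gamma> $ 1 - \<Gamma> $ 2 + \<Gamma> $ 3), pt_half \<Gamma>]"
| "type_vertices Type_G \<Gamma> =
     [pt_a \<Gamma>, pt_c \<Gamma> 3, pt_b \<Gamma>, bracket \<Gamma> (\<Gamma> $ 2) (\<Gamma> $ 2) (\<Gamma> $ 1 - \<Gamma> $ 2 + \<Gamma> $ 3), pt_half \<Gamma>]"
| "type_vertices Type_H \<Gamma> =
     [pt_a \<Gamma>, pt_c \<Gamma> 3, pt_b \<Gamma>, bracket \<Gamma> (\<Gamma> $ 2) (\<Gamma> $ 2) (\<Gamma> $ 1 - \<Gamma> $ 2 + \<Gamma> $ 3), pt_half \<Gamma>]"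

text \<open>The points \<open>c\<^sub>j\<close> that are not vertices all lie on edges starting at \<open>a\<close>.\<close>

fun type_marked_edges :: "polytope_type \<Rightarrow> real^3 \<Rightarrow> bool" where
  "type_marked_edges Type_A \<Gamma> \<longleftrightarrow>
     ordered_in_segment (pt_a \<Gamma>) [pt_c \<Gamma> 3, pt_c \<Gamma> 2, pt_c \<Gamma> 1] (pt_half \<Gamma>)"
| "type_marked_edges Type_B \<Gamma> \<longleftrightarrow>
     ordered_in_segment (pt_a \<Gamma>) [pt_c \<Gamma> 3, pt_c \<Gamma> 2] (pt_c \<Gamma> 1)"
| "type_marked_edges Type_C \<Gamma> \<longleftrightarrow>
     ordered_in_segment (pt_a \<Gamma>) [pt_c \<Gamma> 1] (pt_c \<Gamma> 2)"
| "type_marked_edges Type_D \<Gamma> \<longleftrightarrow>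
     ordered_in_segment (pt_a \<Gamma>) [pt_c \<Gamma> 2, pt_c \<Gamma> 3] (pt_c \<Gamma> 1)"
| "type_marked_edges Type_E \<Gamma> \<longleftrightarrow>
     ordered_in_segment (pt_a \<Gamma>) [pt_c \<Gamma> 1] (pt_c \<Gamma> 3)"
| "type_marked_edges Type_F \<Gamma> \<longleftrightarrow>
     ordered_in_segment (pt_a \<Gamma>) [pt_c \<Gamma> 1] (pt_c \<Gamma> 3) \<and>
     ordered_in_segment (pt_a \<Gamma>) [pt_c \<Gamma> 2] (pt_half \<Gamma>)"
| "type_marked_edges Type_G \<Gamma> \<longleftrightarrow>
     ordered_in_segment (pt_a \<Gamma>) [pt_c \<Gamma> 2, pt_c \<Gamma> 1] (pt_c \<Gamma> 3)"
| "type_marked_edges Type_H \<Gamma> \<longleftrightarrow>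
     ordered_in_segment (pt_a \<Gamma>) [pt_c \<Gamma> 1, pt_c \<Gamma> 2] (pt_half \<Gamma>)"

end

theory Submission
  imports Defs
begin

text \<open>
  With \<open>l = x + s/3\<close>, a point \<open>x\<close> of the chamber lies in the polytope iff the diagonal matrix of
  \<open>l\<close> is a sum of rank-one matrices \<open>\<Gamma>\<^sub>j z\<^sub>j z\<^sub>j\<^sup>*\<close> with unit vectors \<open>z\<^sub>j\<close>. Up to the order, only
  the sign patterns \<open>+++\<close>, \<open>++-\<close> and \<open>+--\<close> of the weights occur. For each of them a few linear
  inequalities follow by testing the quadratic form of \<open>l\<close> on coordinate vectors, on \<open>z\<^sub>1\<close>, and
  on vectors orthogonal to some of the \<open>z\<^sub>j\<close>. Conversely, in the plane two weights \<open>\<alpha>, \<beta>\<close> produce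
  every pair of eigenvalues \<open>p, q\<close> of the same trace with \<open>pq\<close> between \<open>0\<close> and \<open>\<alpha>\<beta>\<close>, and two such
  planar steps reach every \<open>l\<close> that satisfies the inequalities. So the polytope is cut
  out of the chamber by at most four linear inequalities, and its vertices and edges are read off.
\<close>

section \<open>Realizable spectra\<close>

definition cdot :: "complex^3 \<Rightarrow> complex^3 \<Rightarrow> complex" where
  "cdot v z = (\<Sum>i\<in>UNIV. cnj (v $ i) * z $ i)"

lemma norm_sq_vec3: "(norm v)\<^sup>2 = (\<Sum>i\<in>UNIV. (cmod (v $ i))\<^sup>2)" for v :: "complex^3"
  by (simp add: norm_vec_def L2_set_def sum_nonneg)

lemma cdot_self: "cdot v v = of_real ((norm v)\<^sup>2)"
  unfolding norm_sq_vec3 cdot_def by (simp add: sum_3 complex_norm_square mult.commute del: of_real_power)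

lemma norm_eq_1_iff_cdot: "norm v = 1 \<longleftrightarrow> cdot v v = 1"
  unfolding cdot_self by (simp add: power2_eq_1_iff flip: of_real_power)
    (metis norm_ge_zero not_one_le_zero neg_0_le_iff_le)

lemma cdot_comb_right: "cdot v (a *\<^sub>R x + b *\<^sub>R y) = of_real a * cdot v x + of_real b * cdot v y"
  by (simp add: cdot_def sum_3 scaleR_conv_of_real[where 'a = complex] algebra_simps)

lemma cdot_comb_left: "cdot (a *\<^sub>R x + b *\<^sub>R y) v = of_real a * cdot x v + of_real b * cdot y v"
  by (simp add: cdot_def sum_3 scaleR_conv_of_real[where 'a = complex] algebra_simps)

lemma cdot_commute: "cdot x y = cnj (cdot y x)"
  by (simp add: cdot_def sum_3 mult.commute)

lemma cmod_cdot_le: "(cmod (cdot v z))\<^sup>2 \<le> (norm v)\<^sup>2 * (norm z)\<^sup>2"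
proof -
  have "cmod (cdot v z) \<le> (\<Sum>i\<in>UNIV. \<bar>cmod (v $ i)\<bar> * \<bar>cmod (z $ i)\<bar>)"
    unfolding cdot_def by (rule order_trans[OF norm_sum]) (simp add: norm_mult)
  also have "\<dots> \<le> norm v * norm z"
    unfolding norm_vec_def by (rule L2_set_mult_ineq)
  finally have "(cmod (cdot v z))\<^sup>2 \<le> (norm v * norm z)\<^sup>2"
    by (rule power_mono) simp
  then show ?thesis by (simp add: power_mult_distrib)
qed

lemma outer_comb:
  "outer (a *\<^sub>R x + b *\<^sub>R y) = a\<^sup>2 *\<^sub>R outer x + b\<^sup>2 *\<^sub>R outer y +
     (a * b) *\<^sub>R (\<chi> i j. x $ i * cnj (y $ j) + y $ i * cnj (x $ j))"
  by (simp add: vec_eq_iff outer_def scaleR_conv_of_real[where 'a = complex] power2_eq_square algebra_simps)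

text \<open>Both sides evaluate the quadratic form v^* M v at the same matrix M, written once as a
  diagonal matrix and once as a weighted sum of rank-one matrices. This is the source of all
  necessary inequalities.\<close>

lemma rayleigh:
  fixes \<Gamma> :: "real^3"
  assumes "(\<Sum>j\<in>UNIV. \<Gamma> $ j *\<^sub>R outer (Z $ j)) = diag_matrix l"
  shows "(\<Sum>i\<in>UNIV. l $ i * (cmod (v $ i))\<^sup>2) = (\<Sum>j\<in>UNIV. \<Gamma> $ j * (cmod (cdot v (Z $ j)))\<^sup>2)"
proof -
  define q where "q M = (\<Sum>i\<in>UNIV. \<Sum>k\<in>UNIV. cnj (v $ i) * M $ i $ k * v $ k)" for M :: "complex^3^3"
  have sc: "q (a *\<^sub>R M) = of_real a * q M" for a M
    by (simp add: q_def scaleR_conv_of_real[where 'a = complex] sum_distrib_left mult_ac)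
  have add: "q (M + N) = q M + q N" for M N
    by (simp add: q_def sum.distrib algebra_simps)
  have out: "q (outer z) = of_real ((cmod (cdot v z))\<^sup>2)" for z
    unfolding complex_norm_square
    by (simp add: q_def outer_def cdot_def sum_3 algebra_simps)
  have dia: "q (diag_matrix l) = of_real (\<Sum>i\<in>UNIV. l $ i * (cmod (v $ i))\<^sup>2)"
    by (simp add: q_def diag_matrix_def sum_3 complex_norm_square mult_ac del: of_real_power)
  have "q (diag_matrix l) = of_real (\<Sum>j\<in>UNIV. \<Gamma> $ j * (cmod (cdot v (Z $ j)))\<^sup>2)"
    unfolding assms[symmetric] by (simp add: sum_3 add sc out del: of_real_power)
  then show ?thesis unfolding dia of_real_eq_iff .
qed

text \<open>Since \<open>(p - \<alpha>)(\<alpha> - q) = \<alpha>\<beta> - pq\<close>, the sign condition says that \<open>pq\<close> lies between \<open>0\<close> and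
  \<open>\<alpha>\<beta>\<close>.\<close>

lemma two_weights_scalar:
  fixes \<alpha> \<beta> p q :: real
  assumes sum: "p + q = \<alpha> + \<beta>" and pos: "0 \<le> p * q * ((p - \<alpha>) * (\<alpha> - q))"
  shows "\<exists>c s c' s'. c\<^sup>2 + s\<^sup>2 = 1 \<and> c'\<^sup>2 + s'\<^sup>2 = 1 \<and> \<alpha> * c\<^sup>2 + \<beta> * c'\<^sup>2 = p \<and>
           \<alpha> * s\<^sup>2 + \<beta> * s'\<^sup>2 = q \<and> \<alpha> * (c * s) + \<beta> * (c' * s') = 0"
proof -
  have b: "\<beta> = p + q - \<alpha>" using sum by simp
  have det: "(p - \<alpha>) * (\<alpha> - q) = \<alpha> * \<beta> - p * q" by (simp add: b algebra_simps)
  consider "q = 0" | "p = 0" | "p * q \<noteq> 0" "p = q" | "p * q \<noteq> 0" "p \<noteq> q" by force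
  then show ?thesis
  proof cases
    case 1
    then show ?thesis using sum by (intro exI[of _ 1] exI[of _ 0]) auto
  next
    case 2
    then show ?thesis using sum by (intro exI[of _ 1] exI[of _ 0]) auto
  next
    case 3
    \<comment> \<open>For p = q the sign condition leaves only the negative of a square, so both
      weights equal p and the two basis vectors themselves serve.\<close>
    have "0 \<le> - (p\<^sup>2 * (p - \<alpha>)\<^sup>2)" using pos 3 by (simp add: power2_eq_square algebra_simps)
    then have "p = \<alpha>" using 3 by (simp add: mult_le_0_iff)
    then show ?thesis using 3 b
      by (intro exI[of _ 1] exI[of _ 0] exI[of _ 0] exI[of _ 1]) auto
  next
    case 4
    have ab: "\<alpha> * \<beta> \<noteq> 0"
    proof
      assume "\<alpha> * \<beta> = 0"
      with pos have "0 \<le> p * q * (- (p * q))" unfolding det by simp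
      then have "0 \<le> - (p * q)\<^sup>2" by (simp add: power2_eq_square)
      then show False using 4 by simp
    qed
    \<comment> \<open>\<open>X \<alpha>\<close> and \<open>X \<beta>\<close> are the squared cosines
      \<open>c\<^sup>2\<close> and \<open>c'\<^sup>2\<close>. They solve
      \<open>\<alpha> X + \<beta> Y = p\<close> together with
      \<open>\<alpha>\<^sup>2 X (1 - X) = \<beta>\<^sup>2 Y (1 - Y)\<close>, which is the vanishing
      of the off-diagonal entry up to sign. Subtracting makes this system linear.\<close>
    define X where "X a = p * (a - q) / (a * (p - q))" for a
    have X01: "0 \<le> X a \<and> X a \<le> 1" if "a \<noteq> 0" "0 \<le> p * q * ((p - a) * (a - q))" for a
    proof -
      have e: "1 - X a = q * (p - a) / (a * (p - q))"
        using that 4 by (simp add: X_def field_simps)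
      have "X a * (1 - X a) = (p * q * ((p - a) * (a - q))) / (a * (p - q))\<^sup>2"
        unfolding e by (simp add: X_def power2_eq_square)
      then have "0 \<le> X a * (1 - X a)" using that by simp
      then show ?thesis by (auto simp: zero_le_mult_iff)
    qed
    have swap: "(p - \<beta>) * (\<beta> - q) = (p - \<alpha>) * (\<alpha> - q)" by (simp add: b algebra_simps)
    have b': "0 \<le> p * q * ((p - \<beta>) * (\<beta> - q))" using pos unfolding swap by simp
    have XA: "0 \<le> X \<alpha>" "X \<alpha> \<le> 1" and XB: "0 \<le> X \<beta>" "X \<beta> \<le> 1"
      using X01[of \<alpha>] X01[of \<beta>] pos b' ab by auto
    have s1: "\<alpha> * X \<alpha> + \<beta> * X \<beta> = p"
    proof -
      have "\<alpha> * X \<alpha> + \<beta> * X \<beta> = (p * (\<alpha> - q) + p * (\<beta> - q)) / (p - q)"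
        using ab 4 by (simp add: X_def add_divide_distrib)
      also have "\<dots> = p" using 4 by (simp add: b field_simps)
      finally show ?thesis .
    qed
    have var: "a\<^sup>2 * (X a * (1 - X a)) = p * q * ((p - a) * (a - q)) / (p - q)\<^sup>2" if "a \<noteq> 0" for a
    proof -
      have e: "1 - X a = q * (p - a) / (a * (p - q))"
        using that 4 by (simp add: X_def field_simps)
      show ?thesis unfolding e using that by (simp add: X_def power2_eq_square)
    qed
    have eqv: "\<alpha>\<^sup>2 * (X \<alpha> * (1 - X \<alpha>)) = \<beta>\<^sup>2 * (X \<beta> * (1 - X \<beta>))"
      using ab by (simp add: var swap)
    define r where "r a = sqrt (X a * (1 - X a))" for a
    have eqr: "\<bar>\<alpha>\<bar> * r \<alpha> = \<bar>\<beta>\<bar> * r \<beta>"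
      using arg_cong[OF eqv, of sqrt] by (simp add: r_def real_sqrt_mult)
    \<comment> \<open>The two off-diagonal contributions have equal modulus. This sign, put on one
      of the sines, makes them cancel.\<close>
    define e where "e = - sgn (\<alpha> * \<beta>)"
    have e2: "e\<^sup>2 = 1" using ab by (simp add: e_def sgn_mult power_mult_distrib sgn_if)
    have "\<alpha> * r \<alpha> + \<beta> * (e * r \<beta>) = 0"
      using eqr ab by (auto simp: e_def sgn_if abs_if zero_less_mult_iff split: if_splits)
    then have cross: "\<alpha> * (sqrt (X \<alpha>) * sqrt (1 - X \<alpha>)) + \<beta> * (sqrt (X \<beta>) * (e * sqrt (1 - X \<beta>))) = 0"
      by (simp add: r_def real_sqrt_mult mult_ac)
    have s2: "\<alpha> * (1 - X \<alpha>) + \<beta> * (1 - X \<beta>) = q" using s1 sum by (simp add: right_diff_distrib)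
    show ?thesis
      by (rule exI[of _ "sqrt (X \<alpha>)"], rule exI[of _ "sqrt (1 - X \<alpha>)"],
          rule exI[of _ "sqrt (X \<beta>)"], rule exI[of _ "e * sqrt (1 - X \<beta>)"])
        (use XA XB s1 s2 cross e2 in \<open>simp add: power_mult_distrib\<close>)
  qed
qed

text \<open>The scalar solution gives the coordinates of u and v in the orthonormal pair e, f. The
  last clause records that u and v stay in the plane of e and f, so that a second planar step can be
  attached.\<close>

lemma two_weights:
  assumes "norm e = 1" "norm f = 1" "cdot e f = 0"
    and "p + q = \<alpha> + \<beta>" "0 \<le> p * q * ((p - \<alpha>) * (\<alpha> - q))"
  obtains u v where "norm u = 1" "norm v = 1"
    "\<alpha> *\<^sub>R outer u + \<beta> *\<^sub>R outer v = p *\<^sub>R outer e + q *\<^sub>R outer f"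
    "\<And>g. cdot g e = 0 \<Longrightarrow> cdot g f = 0 \<Longrightarrow> cdot g u = 0 \<and> cdot g v = 0"
proof -
  obtain c s c' s' where h: "c\<^sup>2 + s\<^sup>2 = 1" "c'\<^sup>2 + s'\<^sup>2 = 1" "\<alpha> * c\<^sup>2 + \<beta> * c'\<^sup>2 = p"
      "\<alpha> * s\<^sup>2 + \<beta> * s'\<^sup>2 = q" "\<alpha> * (c * s) + \<beta> * (c' * s') = 0"
    using two_weights_scalar[OF assms(4,5)] by blast
  have fe: "cdot f e = 0" using assms(3) by (subst cdot_commute) simp
  have nrm: "norm (a *\<^sub>R e + b *\<^sub>R f) = 1" if "a\<^sup>2 + b\<^sup>2 = 1" for a b
  proof -
    have "cdot (a *\<^sub>R e + b *\<^sub>R f) (a *\<^sub>R e + b *\<^sub>R f) = of_real (a\<^sup>2 + b\<^sup>2)"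
      using assms(1,2,3) fe
      by (simp add: cdot_comb_left cdot_comb_right norm_eq_1_iff_cdot power2_eq_square)
    then show ?thesis unfolding norm_eq_1_iff_cdot that by simp
  qed
  let ?M = "(\<chi> i j. e $ i * cnj (f $ j) + f $ i * cnj (e $ j)) :: complex^3^3"
  have "\<alpha> *\<^sub>R outer (c *\<^sub>R e + s *\<^sub>R f) + \<beta> *\<^sub>R outer (c' *\<^sub>R e + s' *\<^sub>R f) =
      (\<alpha> * c\<^sup>2 + \<beta> * c'\<^sup>2) *\<^sub>R outer e + (\<alpha> * s\<^sup>2 + \<beta> * s'\<^sup>2) *\<^sub>R outer f +
      (\<alpha> * (c * s) + \<beta> * (c' * s')) *\<^sub>R ?M"
    unfolding outer_comb by (simp add: algebra_simps)
  then show ?thesis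
    using h nrm by (intro that[of "c *\<^sub>R e + s *\<^sub>R f" "c' *\<^sub>R e + s' *\<^sub>R f"])
      (auto simp: cdot_comb_right)
qed

text \<open>The matrix with rows a, b, 0 is singular. A kernel vector is conjugated, because
  \<open>cdot\<close> is conjugate-linear on the left, and then normalized.\<close>

lemma exists_unit_orthogonal:
  obtains v where "norm v = 1" "cdot v a = 0" "cdot v b = 0"
proof -
  define A :: "complex^3^3" where "A = vector [a, b, 0]"
  have "row 3 A = 0" by (simp add: A_def row_def vec_eq_iff)
  then have "det A = 0" by (rule det_zero_row)
  then obtain x where x: "A *v x = 0" "x \<noteq> 0"
    using invertible_det_nz[of A] by (metis invertible_left_inverse matrix_left_invertible_ker)
  define v where "v = (1 / norm x) *\<^sub>R (\<chi> i. cnj (x $ i))"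
  have "norm (\<chi> i. cnj (x $ i)) = norm x" by (simp add: norm_vec_def)
  then have "norm v = 1" using x by (simp add: v_def)
  moreover have "(A *v x) $ 1 = 0" "(A *v x) $ 2 = 0" using x by simp_all
  then have "cdot v a = 0" "cdot v b = 0"
    by (simp_all add: A_def v_def cdot_def matrix_vector_mult_def sum_3
        scaleR_conv_of_real[where 'a = complex] mult_ac flip: add_divide_distrib)
  ultimately show ?thesis by (rule that)
qed

definition realizable_spectrum :: "real^3 \<Rightarrow> real^3 \<Rightarrow> bool" where
  "realizable_spectrum \<Gamma> l \<longleftrightarrow>
     (\<exists>Z. (\<forall>j. norm (Z $ j) = 1) \<and> (\<Sum>j\<in>UNIV. \<Gamma> $ j *\<^sub>R outer (Z $ j)) = diag_matrix l)"

text \<open>Each point of the projective plane has a unit representative, and adding s/3 to the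
  spectrum undoes the trace correction of the momentum map. From here on only unit vectors and plain
  weighted sums occur.\<close>

lemma momentum_polytope_eq:
  "momentum_polytope \<Gamma> =
     {x \<in> weyl_chamber. realizable_spectrum \<Gamma> (\<chi> i. x $ i + total_weight \<Gamma> / 3)}"
proof -
  have d: "diag_matrix (\<chi> i. x $ i + t) = diag_matrix x + t *\<^sub>R mat 1" for x t
    by (simp add: diag_matrix_def mat_def vec_eq_iff scaleR_conv_of_real[where 'a = complex])
  have surj: "\<exists>Z. (\<forall>j. norm (Z $ j) = 1) \<and> p = (\<chi> j. abs_cp2 (Z $ j))" for p
  proof (intro exI conjI allI)
    let ?Z = "\<chi> j. SOME z. phase_equiv z z \<and> abs_cp2 z = p $ j"
    have "\<exists>z. phase_equiv z z \<and> abs_cp2 z = q" for q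
      using Quotient_cp2 by (metis Quotient_abs_rep Quotient_rep_reflp)
    then have ex: "phase_equiv (?Z $ j) (?Z $ j) \<and> abs_cp2 (?Z $ j) = p $ j" for j
      unfolding vec_lambda_beta by (rule someI_ex)
    show "norm (?Z $ j) = 1" for j using ex[of j] by (simp add: phase_equiv_def)
    show "p = (\<chi> j. abs_cp2 (?Z $ j))" using ex by (simp add: vec_eq_iff)
  qed
  have "diag_matrix x \<in> range (momentum_map \<Gamma>) \<longleftrightarrow>
      realizable_spectrum \<Gamma> (\<chi> i. x $ i + total_weight \<Gamma> / 3)" for x
  proof -
    have "diag_matrix x \<in> range (momentum_map \<Gamma>) \<longleftrightarrow>
        (\<exists>Z. (\<forall>j. norm (Z $ j) = 1) \<and> diag_matrix x = momentum_lift \<Gamma> Z)"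
    proof
      assume "diag_matrix x \<in> range (momentum_map \<Gamma>)"
      then obtain p where p: "diag_matrix x = momentum_map \<Gamma> p" by blast
      obtain Z where "\<forall>j. norm (Z $ j) = 1" "p = (\<chi> j. abs_cp2 (Z $ j))" using surj by blast
      with p momentum_map_lift[of Z \<Gamma>]
      show "\<exists>Z. (\<forall>j. norm (Z $ j) = 1) \<and> diag_matrix x = momentum_lift \<Gamma> Z" by auto
    next
      assume "\<exists>Z. (\<forall>j. norm (Z $ j) = 1) \<and> diag_matrix x = momentum_lift \<Gamma> Z"
      then show "diag_matrix x \<in> range (momentum_map \<Gamma>)"
        by (metis momentum_map_lift rangeI)
    qed
    then show ?thesis
      unfolding realizable_spectrum_def d momentum_lift_def by (auto simp: eq_diff_eq)
  qed
  then show ?thesis unfolding momentum_polytope_def by blast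
qed

section \<open>Necessary inequalities for the spectrum\<close>

lemma weighted_mean_bounds:
  fixes a b c x y z :: real
  assumes "0 \<le> a" "0 \<le> b" "0 \<le> c" "a + b + c = 1" "x \<ge> y" "y \<ge> z"
  shows "z \<le> x * a + y * b + z * c" "x * a + y * b + z * c \<le> x"
proof -
  have "x * a + y * b + z * c = z + (x - z) * a + (y - z) * b"
    "x * a + y * b + z * c = x - (x - y) * b - (x - z) * c"
    using assms(4) by algebra+
  moreover have "0 \<le> (x - z) * a" "0 \<le> (y - z) * b" "0 \<le> (x - y) * b" "0 \<le> (x - z) * c"
    using assms by (auto intro!: mult_nonneg_nonneg)
  ultimately show "z \<le> x * a + y * b + z * c" "x * a + y * b + z * c \<le> x" by linarith+
qed

text \<open>The value at a unit vector is the mean of the eigenvalues with weights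
  \<open>(cmod (v $ i))\<^sup>2\<close>. A vanishing coordinate removes one eigenvalue from the
  mean, which gives the bounds on the middle one, as in the min-max principle.\<close>

lemma spectrum_rayleigh:
  fixes \<Gamma> :: "real^3"
  assumes unit: "\<And>j. norm (Z $ j) = 1"
    and eq: "(\<Sum>j\<in>UNIV. \<Gamma> $ j *\<^sub>R outer (Z $ j)) = diag_matrix l"
    and ord: "l $ 1 \<ge> l $ 2" "l $ 2 \<ge> l $ 3" and v: "norm v = 1"
  defines "R \<equiv> (\<Sum>j\<in>UNIV. \<Gamma> $ j * (cmod (cdot v (Z $ j)))\<^sup>2)"
  shows "l $ 3 \<le> R" "R \<le> l $ 1" "v $ 1 = 0 \<Longrightarrow> R \<le> l $ 2" "v $ 3 = 0 \<Longrightarrow> l $ 2 \<le> R"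
proof -
  have R: "R = l $ 1 * (cmod (v $ 1))\<^sup>2 + l $ 2 * (cmod (v $ 2))\<^sup>2 + l $ 3 * (cmod (v $ 3))\<^sup>2"
    unfolding R_def rayleigh[OF eq, symmetric] by (simp add: sum_3)
  have s: "(cmod (v $ 1))\<^sup>2 + (cmod (v $ 2))\<^sup>2 + (cmod (v $ 3))\<^sup>2 = 1"
    using norm_sq_vec3[of v] v by (simp add: sum_3)
  note B = weighted_mean_bounds[OF zero_le_power2 zero_le_power2 zero_le_power2 s]
  show "l $ 3 \<le> R" "R \<le> l $ 1" unfolding R by (rule B[OF ord])+
  show "R \<le> l $ 2" if "v $ 1 = 0" using B(2)[OF order_refl ord(2)] that by (simp add: R)
  show "l $ 2 \<le> R" if "v $ 3 = 0" using B(1)[OF ord(1) order_refl] that by (simp add: R)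
qed

lemma cdot_axis [simp]: "cdot (axis i 1) z = z $ i" "cdot z (axis i 1) = cnj (z $ i)"
  by (simp_all add: cdot_def axis_def if_distrib[of cnj] if_distrib[of "\<lambda>x. x * _"]
      if_distrib[of "\<lambda>x. _ * x"] cong: if_cong)

lemma cmod_cdot_unit_le_1: "norm v = 1 \<Longrightarrow> norm z = 1 \<Longrightarrow> (cmod (cdot v z))\<^sup>2 \<le> 1"
  using cmod_cdot_le[of v z] by simp

lemma
  assumes "realizable_spectrum \<Gamma> l" and ord: "l $ 1 \<ge> l $ 2" "l $ 2 \<ge> l $ 3"
  shows realizable_bounds_ppp: "0 < \<Gamma> $ 1 \<Longrightarrow> 0 < \<Gamma> $ 2 \<Longrightarrow> 0 < \<Gamma> $ 3 \<Longrightarrow>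
        0 \<le> l $ 3 \<and> \<Gamma> $ 1 \<le> l $ 1 \<and> l $ 3 \<le> \<Gamma> $ 3" (is "_ \<Longrightarrow> _ \<Longrightarrow> _ \<Longrightarrow> ?ppp")
    and realizable_bounds_ppn: "0 < \<Gamma> $ 1 \<Longrightarrow> 0 < \<Gamma> $ 2 \<Longrightarrow> \<Gamma> $ 3 < 0 \<Longrightarrow>
        0 \<le> l $ 2 \<and> l $ 3 \<le> 0 \<and> \<Gamma> $ 3 \<le> l $ 3 \<and> l $ 2 \<le> \<Gamma> $ 2" (is "_ \<Longrightarrow> _ \<Longrightarrow> _ \<Longrightarrow> ?ppn")
    and realizable_bounds_pnn: "0 < \<Gamma> $ 1 \<Longrightarrow> \<Gamma> $ 2 < 0 \<Longrightarrow> \<Gamma> $ 3 < 0 \<Longrightarrow>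
        l $ 2 \<le> 0 \<and> l $ 1 \<le> \<Gamma> $ 1 \<and> \<Gamma> $ 2 \<le> l $ 2" (is "_ \<Longrightarrow> _ \<Longrightarrow> _ \<Longrightarrow> ?pnn")
    and realizable_trace: "l $ 1 + l $ 2 + l $ 3 = total_weight \<Gamma>"
proof -
  obtain Z where unit: "\<And>j. norm (Z $ j) = 1"
    and eq: "(\<Sum>j\<in>UNIV. \<Gamma> $ j *\<^sub>R outer (Z $ j)) = diag_matrix l"
    using assms(1) by (auto simp: realizable_spectrum_def)
  note R = spectrum_rayleigh[OF unit eq ord, unfolded sum_3]
  let ?c = "\<lambda>v j. (cmod (cdot v (Z $ j)))\<^sup>2"
  have c1: "?c v j \<le> 1" if "norm v = 1" for v j
    using that unit by (rule cmod_cdot_unit_le_1)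
  have up: "g * ?c v j \<le> g" if "norm v = 1" "0 < g" for v j g
    using c1[OF that(1)] that(2) by (simp add: mult_left_le)
  have lo: "g \<le> g * ?c v j" if "norm v = 1" "g < 0" for v j g
    using c1[OF that(1), of j] that(2) by (simp add: mult_le_cancel_left1)
  have self: "?c (Z $ j) j = 1" for j by (simp add: cdot_self unit)
  have pos: "0 \<le> g * ?c v j" if "0 < g" for g v j using that by simp
  have neg: "g * ?c v j \<le> 0" if "g < 0" for g v j using that by (simp add: mult_le_0_iff)
  have n: "norm (axis i 1 :: complex^3) = 1" for i by simp
  have tr: "(\<Sum>i\<in>UNIV. (cmod (Z $ j $ i))\<^sup>2) = 1" for j
    using norm_sq_vec3[of "Z $ j"] unit by simp
  have l: "l $ i = \<Gamma> $ 1 * ?c (axis i 1) 1 + \<Gamma> $ 2 * ?c (axis i 1) 2 + \<Gamma> $ 3 * ?c (axis i 1) 3" for i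
    using rayleigh[OF eq, of "axis i 1"]
    by (simp add: sum_3 axis_def if_distrib[of cmod] if_distrib[of "\<lambda>x. x\<^sup>2"] cong: if_cong)
      (use exhaust_3[of i] in auto)
  show "l $ 1 + l $ 2 + l $ 3 = total_weight \<Gamma>"
    using tr[of 1] tr[of 2] tr[of 3] unfolding l[of 1] l[of 2] l[of 3] sum_3 total_weight_def cdot_axis
    by algebra
  \<comment> \<open>The test vectors: v sees only the third weight; w sees only the last two weights
    and bounds \<open>l $ 2\<close> from above; u sees only the first two weights and bounds
    \<open>l $ 2\<close> from below. Coordinate vectors and \<open>Z $ 1\<close> give the other
    bounds.\<close>
  obtain v where v: "norm v = 1" "cdot v (Z $ 1) = 0" "cdot v (Z $ 2) = 0"
    by (rule exists_unit_orthogonal)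
  obtain w where w: "norm w = 1" "cdot w (Z $ 1) = 0" "w $ 3 = 0"
    using exists_unit_orthogonal[of "Z $ 1" "axis 3 1"] by auto
  obtain u where u: "norm u = 1" "cdot u (Z $ 3) = 0" "u $ 1 = 0"
    using exists_unit_orthogonal[of "Z $ 3" "axis 1 1"] by auto
  have z: "g * (cmod 0)\<^sup>2 = 0" for g by simp
  show ?ppp if "0 < \<Gamma> $ 1" "0 < \<Gamma> $ 2" "0 < \<Gamma> $ 3"
    using R(2)[OF unit[of 1], unfolded self] R(1)[OF v(1), unfolded v(2,3) z] up[OF v(1) that(3), of 3]
      pos[OF that(1), of "axis 3 1" 1] pos[OF that(2), of "axis 3 1" 2] pos[OF that(3), of "axis 3 1" 3]
      pos[OF that(2), of "Z $ 1" 2] pos[OF that(3), of "Z $ 1" 3] l[of 3]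
    by linarith
  show ?ppn if "0 < \<Gamma> $ 1" "0 < \<Gamma> $ 2" "\<Gamma> $ 3 < 0"
    using R(3)[OF u(1,3), unfolded u(2) z] pos[OF that(1), of u 1] pos[OF that(2), of u 2]
      R(1)[OF v(1), unfolded v(2,3) z] neg[OF that(3), of v 3]
      l[of 3] pos[OF that(1), of "axis 3 1" 1] pos[OF that(2), of "axis 3 1" 2] lo[OF n that(3), of 3 3]
      R(4)[OF w(1,3), unfolded w(2) z] up[OF w(1) that(2), of 2] neg[OF that(3), of w 3]
    by linarith
  show ?pnn if "0 < \<Gamma> $ 1" "\<Gamma> $ 2 < 0" "\<Gamma> $ 3 < 0"
    using R(4)[OF w(1,3), unfolded w(2) z] neg[OF that(2), of w 2] neg[OF that(3), of w 3]
      l[of 1] up[OF n that(1), of 1 1] neg[OF that(2), of "axis 1 1" 2] neg[OF that(3), of "axis 1 1" 3]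
      R(3)[OF u(1,3), unfolded u(2) z] pos[OF that(1), of u 1] lo[OF u(1) that(2), of 2]
    by linarith
qed

section \<open>Sufficiency of the inequalities by two planar steps\<close>

lemma UNIV_3_distinct: "distinct [i, j, k :: 3] \<Longrightarrow> UNIV = {i, j, k}"
  by (rule card_subset_eq[symmetric]) auto

text \<open>Read backwards: \<open>\<tau>\<close> and \<open>\<Gamma>\<^sub>c\<close> produce \<open>l\<^sub>j, l\<^sub>k\<close> in one plane, then \<open>\<Gamma>\<^sub>a\<close> and \<open>\<Gamma>\<^sub>b\<close> produce
  \<open>l\<^sub>i, \<tau>\<close> in a second one. The vector carrying \<open>\<tau>\<close> is common to both.\<close>

lemma realizable_two_steps:
  assumes ijk: "distinct [i, j, k :: 3]" and abc: "distinct [a, b, c :: 3]"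
    and "l $ i + \<tau> = \<Gamma> $ a + \<Gamma> $ b" "0 \<le> l $ i * \<tau> * ((l $ i - \<Gamma> $ a) * (\<Gamma> $ a - \<tau>))"
    and "l $ j + l $ k = \<tau> + \<Gamma> $ c" "0 \<le> l $ j * l $ k * ((l $ j - \<tau>) * (\<tau> - l $ k))"
  shows "realizable_spectrum \<Gamma> l"
proof -
  have ax: "cdot (axis j 1) (axis k 1) = 0" "cdot (axis i 1) (axis j 1) = 0"
      "cdot (axis i 1) (axis k 1) = 0"
    using ijk unfolding cdot_axis by (auto simp: axis_def)
  have n: "norm (axis m 1 :: complex^3) = 1" for m by simp
  obtain p z where pz: "norm p = 1" "norm z = 1"
      "\<tau> *\<^sub>R outer p + \<Gamma> $ c *\<^sub>R outer z = l $ j *\<^sub>R outer (axis j 1) + l $ k *\<^sub>R outer (axis k 1)"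
      "cdot (axis i 1) p = 0"
    using two_weights[OF n n ax(1) assms(5,6)] ax(2,3) by metis
  \<comment> \<open>The vector p lies in the plane of the axes j and k, so it forms an orthonormal
    pair with the axis i, and the planar construction applies again.\<close>
  obtain u v where uv: "norm u = 1" "norm v = 1"
      "\<Gamma> $ a *\<^sub>R outer u + \<Gamma> $ b *\<^sub>R outer v = l $ i *\<^sub>R outer (axis i 1) + \<tau> *\<^sub>R outer p"
    using two_weights[OF n pz(1,4) assms(3,4)] by metis
  define Z where "Z = (\<chi> m. if m = a then u else if m = b then v else z)"
  have "(\<Sum>m\<in>UNIV. \<Gamma> $ m *\<^sub>R outer (Z $ m)) =
      \<Gamma> $ a *\<^sub>R outer u + \<Gamma> $ b *\<^sub>R outer v + \<Gamma> $ c *\<^sub>R outer z"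
    using abc unfolding UNIV_3_distinct[OF abc] by (auto simp: Z_def)
  also have "\<dots> = l $ i *\<^sub>R outer (axis i 1) + l $ j *\<^sub>R outer (axis j 1) + l $ k *\<^sub>R outer (axis k 1)"
    unfolding uv(3) using pz(3) by (simp add: add.assoc)
  also have "\<dots> = (\<Sum>m\<in>UNIV. l $ m *\<^sub>R outer (axis m 1))"
    using ijk unfolding UNIV_3_distinct[OF ijk] by auto
  also have "\<dots> = diag_matrix l"
    by (simp add: vec_eq_iff diag_matrix_def outer_def axis_def sum_3 forall_3
        scaleR_conv_of_real[where 'a = complex])
  finally show ?thesis
    unfolding realizable_spectrum_def using uv pz by (intro exI[of _ Z]) (auto simp: Z_def)
qed

text \<open>The factor \<open>(p - \<alpha>) * (\<alpha> - q)\<close> is nonnegative exactly when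
  \<alpha> lies between p and q. The condition of a planar step thus becomes a disjunction of linear
  inequalities.\<close>

lemma interlacing_sign:
  fixes p q \<alpha> :: real
  assumes "(0 \<le> p \<and> 0 \<le> q \<or> p \<le> 0 \<and> q \<le> 0) \<and> (\<alpha> \<le> p \<and> q \<le> \<alpha> \<or> p \<le> \<alpha> \<and> \<alpha> \<le> q) \<or>
    (0 \<le> p \<and> q \<le> 0 \<or> p \<le> 0 \<and> 0 \<le> q) \<and> (\<alpha> \<le> p \<and> \<alpha> \<le> q \<or> p \<le> \<alpha> \<and> q \<le> \<alpha>)"
  shows "0 \<le> p * q * ((p - \<alpha>) * (\<alpha> - q))"
  using assms
  by (elim disjE) (auto intro: mult_nonneg_nonneg mult_nonpos_nonpos simp: zero_le_mult_iff mult_le_0_iff)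

text \<open>The weight \<open>\<Gamma> $ 1\<close> is kept for the plane with common value \<tau>,
  where it has to lie between the two eigenvalues. If \<open>l $ 2 \<le> \<Gamma> $ 1\<close>, these
  are \<open>l $ 1\<close> and \<open>l $ 2\<close>, and \<open>l $ 3\<close> is split off.
  Otherwise \<open>l $ 2\<close> is split off, and \<tau> =
  \<open>l $ 1 + l $ 3 - \<Gamma> $ 1\<close> is at least \<open>l $ 3\<close>, hence
  nonnegative.\<close>

lemma realizable_ppp:
  assumes "\<Gamma> $ 1 > \<Gamma> $ 2" "\<Gamma> $ 2 > \<Gamma> $ 3" "\<Gamma> $ 3 > 0" and "l $ 1 \<ge> l $ 2" "l $ 2 \<ge> l $ 3"
    and "l $ 1 + l $ 2 + l $ 3 = total_weight \<Gamma>"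
    and "0 \<le> l $ 3" "\<Gamma> $ 1 \<le> l $ 1" "l $ 3 \<le> \<Gamma> $ 3"
  shows "realizable_spectrum \<Gamma> l"
proof -
  have tr: "l $ 1 + l $ 2 + l $ 3 = \<Gamma> $ 1 + \<Gamma> $ 2 + \<Gamma> $ 3"
    using assms(6) by (simp add: total_weight_def sum_3)
  show ?thesis
  proof (cases "l $ 2 \<le> \<Gamma> $ 1")
    case True
    show ?thesis
      by (rule realizable_two_steps[of 3 1 2 2 3 1 _ "\<Gamma> $ 2 + \<Gamma> $ 3 - l $ 3"]; (rule interlacing_sign)?;
          use assms tr True in \<open>(simp; fail) | linarith | smt (verit)\<close>)
  next
    case False
    show ?thesis
      by (rule realizable_two_steps[of 2 1 3 2 3 1 _ "\<Gamma> $ 2 + \<Gamma> $ 3 - l $ 2"]; (rule interlacing_sign)?;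
          use assms tr False in \<open>(simp; fail) | linarith | smt (verit)\<close>)
  qed
qed

text \<open>Again \<open>\<Gamma> $ 1\<close> is kept. The case distinction settles the sign of
  \<tau>: splitting off \<open>l $ 3\<close> gives \<tau> =
  \<open>l $ 1 + l $ 2 - \<Gamma> $ 1 \<ge> l $ 2 \<ge> 0\<close> in the first case, and splitting
  off \<open>l $ 2\<close> gives \<tau> =
  \<open>l $ 1 + l $ 3 - \<Gamma> $ 1 < l $ 3 \<le> 0\<close> in the second.\<close>

lemma realizable_ppn:
  assumes "\<Gamma> $ 1 > \<Gamma> $ 2" "\<Gamma> $ 2 > 0" "0 > \<Gamma> $ 3" and "l $ 1 \<ge> l $ 2" "l $ 2 \<ge> l $ 3"
    and "l $ 1 + l $ 2 + l $ 3 = total_weight \<Gamma>"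
    and "0 \<le> l $ 2" "l $ 3 \<le> 0" "\<Gamma> $ 3 \<le> l $ 3" "l $ 2 \<le> \<Gamma> $ 2"
  shows "realizable_spectrum \<Gamma> l"
proof -
  have tr: "l $ 1 + l $ 2 + l $ 3 = \<Gamma> $ 1 + \<Gamma> $ 2 + \<Gamma> $ 3"
    using assms(6) by (simp add: total_weight_def sum_3)
  show ?thesis
  proof (cases "l $ 1 \<ge> \<Gamma> $ 1")
    case True
    show ?thesis
      by (rule realizable_two_steps[of 3 1 2 2 3 1 _ "\<Gamma> $ 2 + \<Gamma> $ 3 - l $ 3"]; (rule interlacing_sign)?;
          use assms tr True in \<open>(simp; fail) | linarith | smt (verit)\<close>)
  next
    case False
    show ?thesis
      by (rule realizable_two_steps[of 2 1 3 2 3 1 _ "\<Gamma> $ 2 + \<Gamma> $ 3 - l $ 2"]; (rule interlacing_sign)?;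
          use assms tr False in \<open>(simp; fail) | linarith | smt (verit)\<close>)
  qed
qed

text \<open>Here \<open>\<Gamma> $ 3\<close> is kept. Splitting off \<open>l $ 1\<close> gives
  \<tau> = \<open>l $ 2 + l $ 3 - \<Gamma> $ 3 \<le> l $ 2 \<le> 0\<close>; splitting off
  \<open>l $ 2\<close> gives \<tau> = \<open>l $ 1 + l $ 3 - \<Gamma> $ 3 > l $ 1\<close>. The
  positive total weight makes \<open>l $ 1\<close> positive.\<close>

lemma realizable_pnn:
  assumes "\<Gamma> $ 1 > 0" "0 > \<Gamma> $ 2" "\<Gamma> $ 2 > \<Gamma> $ 3" and "l $ 1 \<ge> l $ 2" "l $ 2 \<ge> l $ 3"
    and "l $ 1 + l $ 2 + l $ 3 = total_weight \<Gamma>" "0 < total_weight \<Gamma>"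
    and "l $ 2 \<le> 0" "l $ 1 \<le> \<Gamma> $ 1" "\<Gamma> $ 2 \<le> l $ 2"
  shows "realizable_spectrum \<Gamma> l"
proof -
  have tr: "l $ 1 + l $ 2 + l $ 3 = \<Gamma> $ 1 + \<Gamma> $ 2 + \<Gamma> $ 3"
    using assms(6) by (simp add: total_weight_def sum_3)
  show ?thesis
  proof (cases "l $ 3 \<le> \<Gamma> $ 3")
    case True
    show ?thesis
      by (rule realizable_two_steps[of 1 3 2 2 1 3 _ "\<Gamma> $ 1 + \<Gamma> $ 2 - l $ 1"]; (rule interlacing_sign)?;
          use assms tr True in \<open>(simp; fail) | linarith | smt (verit)\<close>)
  next
    case False
    show ?thesis
      by (rule realizable_two_steps[of 2 1 3 2 1 3 _ "\<Gamma> $ 1 + \<Gamma> $ 2 - l $ 2"]; (rule interlacing_sign)?;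
          use assms tr False in \<open>(simp; fail) | linarith | smt (verit)\<close>)
  qed
qed

section \<open>Convex polygons in a plane\<close>

text \<open>A point outside the hull is separated from it by a linear functional. At a vertex where that
  functional is minimal, it is a nonnegative combination of the functionals of the two adjacent
  edges, so one of the inequalities of these edges fails at the point.\<close>

lemma convex_polygon_of_supporting_lines:
  fixes vs :: "(real^3) list" and h :: "nat \<Rightarrow> real^3" and c :: "nat \<Rightarrow> real"
  defines "n \<equiv> length vs"
  assumes A: "affine A" "aff_dim A = 2" "set vs \<subseteq> A" and n: "3 \<le> n"
    and on: "\<And>i. i < n \<Longrightarrow> h i \<bullet> vs ! i = c i"
      "\<And>i. i < n \<Longrightarrow> h i \<bullet> vs ! (Suc i mod n) = c i"
    and off: "\<And>i k. i < n \<Longrightarrow> k < n \<Longrightarrow> k \<noteq> i \<Longrightarrow> k \<noteq> Suc i mod n \<Longrightarrow> h i \<bullet> vs ! k > c i"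
  shows "convex_polygon vs {x \<in> A. \<forall>i<n. h i \<bullet> x \<ge> c i}" (is "convex_polygon vs ?R")
proof -
  define P where "P = convex hull (set vs)"
  define s where "s i = Suc i mod n" for i
  \<comment> \<open>Adding n before subtracting 1 gives the cyclic predecessor also at 0, where
    subtraction on natural numbers would be cut off.\<close>
  define p where "p i = (i + n - 1) mod n" for i
  have s: "s i < n" for i using n by (simp add: s_def)
  have p: "p i < n" for i using n by (simp add: p_def)
  have s': "s i = (if Suc i = n then 0 else Suc i)" if "i < n" for i
    using that by (auto simp: s_def)
  have p': "p i = (if i = 0 then n - 1 else i - 1)" if "i < n" for i
    using that n by (auto simp: p_def mod_if)
  have sp: "s (p i) = i" if "i < n" for i
    unfolding p'[OF that] using that n by (auto simp: s')
  have ne: "s i \<noteq> i" "p i \<noteq> i" "p i \<noteq> s i" if "i < n" for i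
    using that n by (auto simp: s' p')
  note on = on[folded s_def] and off = off[folded s_def]
  have ge: "h i \<bullet> vs ! k \<ge> c i" if "i < n" "k < n" for i k
    using on[OF that(1)] off[OF that] by (cases "k = i"; cases "k = s i") auto
  have inj: "i = k" if "i < n" "k < n" "vs ! i = vs ! k" for i k
  proof (rule ccontr)
    assume ik: "i \<noteq> k"
    show False
    proof (cases "k = s i")
      case False
      with off[OF that(1,2)] on(1)[OF that(1)] ik that(3) show False by simp
    next
      case True
      \<comment> \<open>With at least three vertices, two indices cannot be successors of each
        other, so the line of edge k separates the two points.\<close>
      have "i \<noteq> s k" using that n ik True by (auto simp: s' split: if_splits)
      with off[OF that(2,1)] on(1)[OF that(2)] ik that(3) show False by simp
    qed
  qed
  have dist: "distinct vs" unfolding distinct_conv_nth using inj by (auto simp: n_def)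
  have vsA: "vs ! i \<in> A" if "i < n" for i using A that by (auto simp: n_def)
  have vsP: "vs ! i \<in> P" if "i < n" for i
    unfolding P_def by (rule hull_inc) (use that in \<open>simp add: n_def\<close>)
  have set_vs: "set vs = (!) vs ` {..<n}" by (auto simp: in_set_conv_nth n_def image_iff)

  \<comment> \<open>The functional \<open>h i\<close> is constant along the edge from vertex i to
    its successor but larger at its predecessor. The two edge directions at a vertex are therefore
    independent and give oblique coordinates on the plane.\<close>
  have corner: "\<exists>a b. x = vs ! i + a *\<^sub>R (vs ! p i - vs ! i) + b *\<^sub>R (vs ! s i - vs ! i)"
    if i: "i < n" and x: "x \<in> A" for i x
  proof -
    let ?T = "{vs ! i, vs ! p i, vs ! s i}"
    have "\<not> collinear ?T"
    proof
      assume "collinear ?T"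
      then obtain u where u: "\<And>x y. x \<in> ?T \<Longrightarrow> y \<in> ?T \<Longrightarrow> \<exists>t. x - y = t *\<^sub>R u"
        unfolding collinear_def by blast
      obtain t1 where t1: "vs ! p i - vs ! i = t1 *\<^sub>R u" using u by blast
      obtain t2 where t2: "vs ! s i - vs ! i = t2 *\<^sub>R u" using u by blast
      have "h i \<bullet> (vs ! p i - vs ! i) > 0"
        using off[OF i p, of i] ne[OF i] on(1)[OF i] by (simp add: inner_diff_right)
      then have 1: "t1 * (h i \<bullet> u) > 0" by (simp add: t1)
      have "h i \<bullet> (vs ! s i - vs ! i) = 0" using on[OF i] by (simp add: inner_diff_right)
      then have "t2 * (h i \<bullet> u) = 0" by (simp add: t2)
      with 1 have "t2 = 0" by auto
      then have "vs ! s i = vs ! i" using t2 by simp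
      then show False using inj[OF s i] ne[OF i] by simp
    qed
    then have "aff_dim ?T \<ge> 2" by (simp add: collinear_aff_dim)
    moreover have sub: "affine hull ?T \<subseteq> A"
      using vsA i s p A(1) by (intro hull_minimal) auto
    then have "aff_dim (affine hull ?T) \<le> 2" using aff_dim_subset A(2) by metis
    ultimately have "affine hull ?T = A"
      using A sub by (intro affine_dim_equal) auto
    with x obtain a b d where "x = a *\<^sub>R vs ! i + b *\<^sub>R vs ! p i + d *\<^sub>R vs ! s i" "a + b + d = 1"
      by (auto simp: affine_hull_3)
    moreover from this(2) have "a = 1 - b - d" by simp
    ultimately have "x = vs ! i + b *\<^sub>R (vs ! p i - vs ! i) + d *\<^sub>R (vs ! s i - vs ! i)"
      by (simp add: algebra_simps)
    then show ?thesis by blast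
  qed

  have PR: "P \<subseteq> ?R"
  proof -
    have "convex ?R"
    proof -
      have "?R = A \<inter> (\<Inter>i\<in>{..<n}. {x. h i \<bullet> x \<ge> c i})" by auto
      then show ?thesis
        using A(1) by (simp only:) (intro convex_Int convex_INT convex_halfspace_ge affine_imp_convex)
    qed
    then show ?thesis
      unfolding P_def using A(3) ge by (intro hull_minimal) (auto simp: set_vs)
  qed
  have RP: "?R \<subseteq> P"
  proof
    fix x assume x: "x \<in> ?R"
    show "x \<in> P"
    proof (rule ccontr)
      assume "x \<notin> P"
      have "closed P" unfolding P_def by (simp add: compact_imp_closed finite_imp_compact_convex_hull)
      then obtain g b where g: "g \<bullet> x < b" "\<And>y. y \<in> P \<Longrightarrow> b < g \<bullet> y"
        using separating_hyperplane_closed_point[of P x] \<open>x \<notin> P\<close> by (auto simp: P_def)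
      define i where "i = arg_min_on (\<lambda>i. g \<bullet> vs ! i) {..<n}"
      have "0 \<in> {..<n}" using n by simp
      then have "{..<n} \<noteq> {}" by blast
      then have i: "i < n" "\<And>k. k < n \<Longrightarrow> g \<bullet> vs ! i \<le> g \<bullet> vs ! k"
        using arg_min_if_finite(1)[of "{..<n}" "\<lambda>i. g \<bullet> vs ! i"]
          arg_min_least[of "{..<n}" _ "\<lambda>i. g \<bullet> vs ! i"] by (auto simp: i_def)
      obtain a d where ad: "x = vs ! i + a *\<^sub>R (vs ! p i - vs ! i) + d *\<^sub>R (vs ! s i - vs ! i)"
        using corner[OF i(1)] x by blast
      \<comment> \<open>Since \<open>h i\<close> is constant along the edge to the successor, it
        sees only the coordinate a. In the same way \<open>h (p i)\<close> sees only d.\<close>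
      have "h i \<bullet> x = c i + a * (h i \<bullet> vs ! p i - c i)"
        using on[OF i(1)] by (simp add: ad inner_add_right inner_diff_right)
      moreover have "h i \<bullet> vs ! p i > c i" using off[OF i(1) p] ne[OF i(1)] by blast
      moreover have "h i \<bullet> x \<ge> c i" using x i by auto
      ultimately have a: "0 \<le> a" by (simp add: zero_le_mult_iff)
      have "h (p i) \<bullet> x = c (p i) + d * (h (p i) \<bullet> vs ! s i - c (p i))"
        using on[OF p, of i] by (simp add: ad inner_add_right inner_diff_right sp[OF i(1)])
      moreover have "h (p i) \<bullet> vs ! s i > c (p i)"
        using off[OF p s, of i i] ne[OF i(1)] by (auto simp: sp[OF i(1)])
      moreover have "h (p i) \<bullet> x \<ge> c (p i)" using x p by auto
      ultimately have d: "0 \<le> d" by (simp add: zero_le_mult_iff)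
      have "g \<bullet> x = g \<bullet> vs ! i + a * (g \<bullet> vs ! p i - g \<bullet> vs ! i) + d * (g \<bullet> vs ! s i - g \<bullet> vs ! i)"
        by (simp add: ad inner_add_right inner_diff_right)
      then have "g \<bullet> x \<ge> g \<bullet> vs ! i" using a d i(2)[OF p, of i] i(2)[OF s, of i] by simp
      then show False using g(1) g(2)[OF vsP[OF i(1)]] by simp
    qed
  qed
  have P: "?R = P" using PR RP by blast
  have cP: "convex P" unfolding P_def by simp

  have dim: "aff_dim P = 2"
  proof -
    have i: "0 < n" using n by simp
    have "A \<subseteq> affine hull P"
    proof
      fix x assume "x \<in> A"
      then obtain a b where x: "x = vs ! 0 + a *\<^sub>R (vs ! p 0 - vs ! 0) + b *\<^sub>R (vs ! s 0 - vs ! 0)"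
        using corner[OF i] by blast
      have "vs ! 0 \<in> affine hull P" "vs ! p 0 \<in> affine hull P" "vs ! s 0 \<in> affine hull P"
        using vsP i p s by (auto intro: hull_inc)
      then show "x \<in> affine hull P" unfolding x
        using mem_affine_3_minus[OF affine_affine_hull] by (metis add.assoc)
    qed
    then have "aff_dim A \<le> aff_dim P" by (metis aff_dim_affine_hull aff_dim_subset)
    moreover have "P \<subseteq> A" using P by auto
    then have "aff_dim P \<le> aff_dim A" by (rule aff_dim_subset)
    ultimately show ?thesis using A(2) by simp
  qed

  have face: "closed_segment (vs ! i) (vs ! s i) face_of P" if i: "i < n" for i
  proof -
    let ?F = "P \<inter> {x. h i \<bullet> x = c i}"
    \<comment> \<open>A supporting line cuts out a face, and a face of a hull is the hull of some of
      its generators. By the strict inequalities only the two endpoints of the side remain.\<close>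
    have F: "?F face_of P"
      using cP by (rule face_of_Int_supporting_hyperplane_ge) (use P i in auto)
    have "compact (set vs)" by (simp add: finite_imp_compact)
    then obtain S where S: "S \<subseteq> set vs" "?F = convex hull S"
      using face_of_convex_hull_subset F unfolding P_def by metis
    have "S \<subseteq> {vs ! i, vs ! s i}"
    proof
      fix y assume y: "y \<in> S"
      then obtain k where k: "k < n" "y = vs ! k" using S(1) by (auto simp: set_vs)
      have "y \<in> ?F" unfolding S(2) using y by (rule hull_inc)
      then show "y \<in> {vs ! i, vs ! s i}" using off[OF i k(1)] k by auto
    qed
    then have "?F \<subseteq> closed_segment (vs ! i) (vs ! s i)"
      unfolding S(2) segment_convex_hull by (rule hull_mono)
    moreover have "closed_segment (vs ! i) (vs ! s i) \<subseteq> ?F"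
      using on[OF i] vsP[OF i] vsP[OF s]
      by (intro closed_segment_subset) (auto intro!: convex_Int cP convex_hyperplane)
    ultimately show ?thesis using F by (metis subset_antisym)
  qed
  have seg_dim: "aff_dim (closed_segment (vs ! i) (vs ! s i)) = 1" if i: "i < n" for i
    using inj[OF i s] ne[OF i] by (metis aff_dim_2 aff_dim_convex_hull segment_convex_hull)

  have edges: "e edge_of P \<longleftrightarrow> (\<exists>i<n. e = closed_segment (vs ! i) (vs ! s i))" for e
  proof
    assume "\<exists>i<n. e = closed_segment (vs ! i) (vs ! s i)"
    then show "e edge_of P" using face seg_dim by (auto simp: edge_of_def)
  next
    assume "e edge_of P"
    then have e: "e face_of P" "aff_dim e = 1" by (auto simp: edge_of_def)
    have ce: "convex e" using e(1) by (rule face_of_imp_convex)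
    have "compact (set vs)" by (simp add: finite_imp_compact)
    then obtain S where S: "S \<subseteq> set vs" "e = convex hull S"
      using face_of_convex_hull_subset e(1) unfolding P_def by metis
    have "\<not> S \<subseteq> {y}" for y
    proof
      assume "S \<subseteq> {y}"
      then have "aff_dim S \<le> 0" using aff_dim_subset[of S "{y}"] by simp
      then show False using e(2) by (simp add: S(2) aff_dim_convex_hull)
    qed
    then obtain y z where yz: "y \<in> S" "z \<in> S" "y \<noteq> z" by blast
    then have "y \<in> set vs" "z \<in> set vs" using S(1) by auto
    then obtain j k where jk: "j < n" "k < n" "y = vs ! j" "z = vs ! k" "j \<noteq> k"
      using yz(3) by (auto simp: set_vs)
    have mem: "vs ! j \<in> e" "vs ! k \<in> e" using yz jk by (auto simp: S(2) intro: hull_inc)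
    have found: "\<exists>i<n. e = closed_segment (vs ! i) (vs ! s i)"
      if i: "i < n" "vs ! i \<in> e" "vs ! s i \<in> e" for i
    proof -
      \<comment> \<open>The side is a face of e of the same dimension 1, whereas proper faces have
        smaller dimension.\<close>
      have sub: "closed_segment (vs ! i) (vs ! s i) \<subseteq> e" using i(2,3) ce by (rule closed_segment_subset)
      have "closed_segment (vs ! i) (vs ! s i) face_of e"
        using face_of_subset[OF face[OF i(1)] sub] e(1) face_of_imp_subset by blast
      then have "closed_segment (vs ! i) (vs ! s i) = e"
        using face_of_aff_dim_lt[OF ce] seg_dim[OF i(1)] e(2) by fastforce
      then show ?thesis using i(1) by blast
    qed
    show "\<exists>i<n. e = closed_segment (vs ! i) (vs ! s i)"
    proof (cases "k = s j \<or> j = s k")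
      case True
      then show ?thesis using found mem jk by metis
    next
      case False
      \<comment> \<open>The midpoint of two non-adjacent vertices satisfies every inequality
        strictly, so it is a relative interior point of P. A face containing such a point is all of
        P, against the dimension of an edge.\<close>
      define m where "m = midpoint (vs ! j) (vs ! k)"
      have "m \<in> e"
        using closed_segment_subset[OF mem ce] by (auto simp: m_def)
      have pos: "h i \<bullet> m > c i" if i: "i < n" for i
      proof -
        have "h i \<bullet> vs ! j > c i \<or> h i \<bullet> vs ! k > c i"
          using off[OF i jk(1)] off[OF i jk(2)] False jk(5) by auto
        then have "2 * (h i \<bullet> m) > 2 * c i"
          using ge[OF i jk(1)] ge[OF i jk(2)]
          by (auto simp: m_def midpoint_def inner_add_right)
        then show ?thesis by simp
      qed
      let ?T = "\<Inter>i\<in>{..<n}. {x. h i \<bullet> x > c i}"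
      have "open ?T" by (intro open_INT ballI open_halfspace_gt) simp
      moreover have "m \<in> ?T \<inter> P" using pos \<open>m \<in> e\<close> face_of_imp_subset[OF e(1)] by auto
      moreover have "affine hull P \<subseteq> A" using A(1) P by (intro hull_minimal) auto
      then have "?T \<inter> affine hull P \<subseteq> P" unfolding P[symmetric] by (auto intro: less_imp_le)
      ultimately have "m \<in> rel_interior P" unfolding mem_rel_interior by blast
      then have "e = P" using face_of_disjoint_rel_interior[OF e(1)] \<open>m \<in> e\<close> by blast
      then show ?thesis using dim e(2) by simp
    qed
  qed

  have ext: "{v. v extreme_point_of P} = set vs"
  proof
    show "{v. v extreme_point_of P} \<subseteq> set vs"
      unfolding P_def using extreme_point_of_convex_hull by blast
    show "set vs \<subseteq> {v. v extreme_point_of P}"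
    proof
      fix v assume "v \<in> set vs"
      then obtain i where i: "i < n" "v = vs ! i" by (auto simp: set_vs)
      \<comment> \<open>A vertex is the intersection of its two adjacent sides, and an intersection
        of faces is a face.\<close>
      have "{v} = closed_segment (vs ! p i) (vs ! s (p i)) \<inter> closed_segment (vs ! i) (vs ! s i)"
      proof -
        have "y = vs ! i" if y: "y \<in> closed_segment (vs ! p i) (vs ! i)" "h i \<bullet> y = c i" for y
        proof -
          obtain t where t: "y = (1 - t) *\<^sub>R vs ! p i + t *\<^sub>R vs ! i"
            using y(1) by (auto simp: in_segment)
          have "h i \<bullet> y = (1 - t) * (h i \<bullet> vs ! p i) + t * c i"
            unfolding t using on(1)[OF i(1)] by (simp add: inner_add_right)
          then have "(1 - t) * (h i \<bullet> vs ! p i - c i) = 0" using y(2) by (simp add: algebra_simps)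
          then have "t = 1" using off[OF i(1) p, of i] ne[OF i(1)] by auto
          then show ?thesis by (simp add: t)
        qed
        moreover have "closed_segment (vs ! i) (vs ! s i) \<subseteq> {y. h i \<bullet> y = c i}"
          using on[OF i(1)] by (intro closed_segment_subset convex_hyperplane) auto
        ultimately show ?thesis by (auto simp: sp[OF i(1)] i(2))
      qed
      moreover have "\<dots> face_of P" using face[OF p] face[OF i(1)] by (rule face_of_Int)
      ultimately have "{v} face_of P" by simp
      then show "v \<in> {v. v extreme_point_of P}" by (simp add: face_of_singleton)
    qed
  qed
  show ?thesis
    unfolding convex_polygon_def P
    using dist dim ext edges unfolding P_def[symmetric] n_def[symmetric] s_def by auto
qed

section \<open>The eight types\<close>

definition trace_free :: "(real^3) set" where
  "trace_free = {x. x $ 1 + x $ 2 + x $ 3 = 0}"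

lemma trace_free_plane: "affine trace_free" "aff_dim trace_free = 2"
proof -
  have e: "trace_free = {x. vector [1, 1, 1] \<bullet> x = 0}"
    by (simp add: trace_free_def inner_vec_def sum_3)
  have "(vector [1, 1, 1] :: real^3) \<noteq> 0" by (simp add: vec_eq_iff forall_3)
  then show "affine trace_free" "aff_dim trace_free = 2"
    unfolding e by (simp_all add: affine_hyperplane aff_dim_hyperplane)
qed

lemma total_weight_eq: "total_weight \<Gamma> = \<Gamma> $ 1 + \<Gamma> $ 2 + \<Gamma> $ 3"
  by (simp add: total_weight_def sum_3)

lemma bracket_nth [simp]:
  "bracket \<Gamma> x y z $ 1 = x - total_weight \<Gamma> / 3"
  "bracket \<Gamma> x y z $ 2 = y - total_weight \<Gamma> / 3"
  "bracket \<Gamma> x y z $ 3 = z - total_weight \<Gamma> / 3"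
  by (simp_all add: bracket_def Let_def)

text \<open>The entry \<open>fs ! i\<close> holds an inner normal and the constant of the line
  through vertex i and the next one. The successor is written with \<open>if\<close>, and all
  quantifiers are bounded, so that for explicit lists the conditions unfold into finitely many
  linear inequalities.\<close>

lemma convex_polygon_from_lines:
  fixes fs :: "((real^3) \<times> real) list"
  assumes "3 \<le> length vs" "length fs = length vs" "\<forall>v\<in>set vs. v \<in> trace_free"
    and L: "\<forall>i<length vs. \<forall>k<length vs.
      if k = i \<or> k = (if Suc i = length vs then 0 else Suc i)
      then fst (fs ! i) \<bullet> vs ! k = snd (fs ! i) else fst (fs ! i) \<bullet> vs ! k > snd (fs ! i)"
    and P: "P = {x \<in> trace_free. \<forall>i<length vs. fst (fs ! i) \<bullet> x \<ge> snd (fs ! i)}"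
  shows "convex_polygon vs P"
  unfolding P
proof (rule convex_polygon_of_supporting_lines[OF trace_free_plane])
  have s: "Suc i mod length vs = (if Suc i = length vs then 0 else Suc i)" if "i < length vs" for i
    using that by auto
  show "fst (fs ! i) \<bullet> vs ! i = snd (fs ! i)" if "i < length vs" for i
    using L that by auto
  show "fst (fs ! i) \<bullet> vs ! (Suc i mod length vs) = snd (fs ! i)" if "i < length vs" for i
  proof -
    have "Suc i mod length vs < length vs" unfolding s[OF that] using that by auto
    from L[rule_format, OF that this] show ?thesis unfolding s[OF that] by simp
  qed
  show "snd (fs ! i) < fst (fs ! i) \<bullet> vs ! k"
    if "i < length vs" "k < length vs" "k \<noteq> i" "k \<noteq> Suc i mod length vs" for i k
    using L that unfolding s[OF that(1)] by metis
qed (use assms in auto)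

section \<open>The polytope as a system of linear inequalities, for each sign pattern\<close>

lemma momentum_polytope_eqI:
  assumes Q: "\<And>l. l $ 1 \<ge> l $ 2 \<Longrightarrow> l $ 2 \<ge> l $ 3 \<Longrightarrow> l $ 1 + l $ 2 + l $ 3 = total_weight \<Gamma> \<Longrightarrow>
      realizable_spectrum \<Gamma> l \<longleftrightarrow> Q (l $ 1) (l $ 2) (l $ 3)"
  defines "t \<equiv> total_weight \<Gamma> / 3"
  shows "momentum_polytope \<Gamma> = {x \<in> trace_free. x $ 1 \<ge> x $ 2 \<and> x $ 2 \<ge> x $ 3 \<and>
    Q (x $ 1 + t) (x $ 2 + t) (x $ 3 + t)}"
proof -
  have "realizable_spectrum \<Gamma> (\<chi> i. x $ i + t) \<longleftrightarrow> Q (x $ 1 + t) (x $ 2 + t) (x $ 3 + t)"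
    if "x \<in> weyl_chamber" for x
    using Q[of "\<chi> i. x $ i + t"] that by (simp add: weyl_chamber_def t_def)
  then show ?thesis
    unfolding momentum_polytope_eq t_def[symmetric]
    by (auto simp: weyl_chamber_def trace_free_def)
qed

lemma momentum_polytope_ppp:
  assumes "decreasing \<Gamma>" "0 < \<Gamma> $ 3"
  defines "t \<equiv> total_weight \<Gamma> / 3"
  shows "momentum_polytope \<Gamma> = {x \<in> trace_free. x $ 1 \<ge> x $ 2 \<and> x $ 2 \<ge> x $ 3 \<and>
    0 \<le> x $ 3 + t \<and> \<Gamma> $ 1 \<le> x $ 1 + t \<and> x $ 3 + t \<le> \<Gamma> $ 3}"
  unfolding t_def
proof (rule momentum_polytope_eqI[where Q = "\<lambda>x y z. 0 \<le> z \<and> \<Gamma> $ 1 \<le> x \<and> z \<le> \<Gamma> $ 3"])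
  have g: "\<Gamma> $ 1 > \<Gamma> $ 2" "\<Gamma> $ 2 > \<Gamma> $ 3" using assms(1) by (auto simp: decreasing_def)
  fix l :: "real^3"
  assume l: "l $ 1 \<ge> l $ 2" "l $ 2 \<ge> l $ 3" "l $ 1 + l $ 2 + l $ 3 = total_weight \<Gamma>"
  show "realizable_spectrum \<Gamma> l \<longleftrightarrow> 0 \<le> l $ 3 \<and> \<Gamma> $ 1 \<le> l $ 1 \<and> l $ 3 \<le> \<Gamma> $ 3"
    using realizable_bounds_ppp[OF _ l(1,2)] realizable_ppp[OF _ _ _ l] g assms(2) by auto
qed

lemma momentum_polytope_ppn:
  assumes "decreasing \<Gamma>" "0 < \<Gamma> $ 2" "\<Gamma> $ 3 < 0"
  defines "t \<equiv> total_weight \<Gamma> / 3"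
  shows "momentum_polytope \<Gamma> = {x \<in> trace_free. x $ 1 \<ge> x $ 2 \<and> x $ 2 \<ge> x $ 3 \<and>
    0 \<le> x $ 2 + t \<and> x $ 3 + t \<le> 0 \<and> \<Gamma> $ 3 \<le> x $ 3 + t \<and> x $ 2 + t \<le> \<Gamma> $ 2}"
  unfolding t_def
proof (rule momentum_polytope_eqI[where Q = "\<lambda>x y z. 0 \<le> y \<and> z \<le> 0 \<and> \<Gamma> $ 3 \<le> z \<and> y \<le> \<Gamma> $ 2"])
  have g: "\<Gamma> $ 1 > \<Gamma> $ 2" "\<Gamma> $ 2 > \<Gamma> $ 3" using assms(1) by (auto simp: decreasing_def)
  fix l :: "real^3"
  assume l: "l $ 1 \<ge> l $ 2" "l $ 2 \<ge> l $ 3" "l $ 1 + l $ 2 + l $ 3 = total_weight \<Gamma>"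
  show "realizable_spectrum \<Gamma> l \<longleftrightarrow> 0 \<le> l $ 2 \<and> l $ 3 \<le> 0 \<and> \<Gamma> $ 3 \<le> l $ 3 \<and> l $ 2 \<le> \<Gamma> $ 2"
    using realizable_bounds_ppn[OF _ l(1,2)] realizable_ppn[OF _ _ _ l] g assms(2,3) by auto
qed

lemma momentum_polytope_pnn:
  assumes "decreasing \<Gamma>" "\<Gamma> $ 2 < 0" "0 < total_weight \<Gamma>"
  defines "t \<equiv> total_weight \<Gamma> / 3"
  shows "momentum_polytope \<Gamma> = {x \<in> trace_free. x $ 1 \<ge> x $ 2 \<and> x $ 2 \<ge> x $ 3 \<and>
    x $ 2 + t \<le> 0 \<and> x $ 1 + t \<le> \<Gamma> $ 1 \<and> \<Gamma> $ 2 \<le> x $ 2 + t}"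
  unfolding t_def
proof (rule momentum_polytope_eqI[where Q = "\<lambda>x y z. y \<le> 0 \<and> x \<le> \<Gamma> $ 1 \<and> \<Gamma> $ 2 \<le> y"])
  have g: "\<Gamma> $ 1 > \<Gamma> $ 2" "\<Gamma> $ 2 > \<Gamma> $ 3" using assms(1) by (auto simp: decreasing_def)
  have g1: "0 < \<Gamma> $ 1" using assms(2,3) g by (simp add: total_weight_eq)
  fix l :: "real^3"
  assume l: "l $ 1 \<ge> l $ 2" "l $ 2 \<ge> l $ 3" "l $ 1 + l $ 2 + l $ 3 = total_weight \<Gamma>"
  show "realizable_spectrum \<Gamma> l \<longleftrightarrow> l $ 2 \<le> 0 \<and> l $ 1 \<le> \<Gamma> $ 1 \<and> \<Gamma> $ 2 \<le> l $ 2"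
    using realizable_bounds_pnn[OF _ l(1,2)] realizable_pnn[OF _ _ _ l assms(3)] g g1 assms(2,3) by auto
qed

section \<open>Positions of the marked points\<close>

lemma pt_c_eqI:
  assumes "{#x, y, z#} = {#\<Gamma> $ i, \<Sum>j\<in>-{i}. \<Gamma> $ j, 0#}" "x \<ge> y" "y \<ge> z"
  shows "pt_c \<Gamma> i = bracket \<Gamma> x y z"
proof -
  \<comment> \<open>A sorted list is determined by its multiset.\<close>
  have "mset [z, y, x] = {#x, y, z#}" by (simp add: add_mset_commute)
  also note assms(1)
  finally have "sort [\<Gamma> $ i, \<Sum>j\<in>-{i}. \<Gamma> $ j, 0] = [z, y, x]"
    using assms(2,3) by (intro properties_for_sort) simp_all
  then show ?thesis by (simp add: pt_c_def Let_def)
qed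

lemma sum_Compl_3:
  "(\<Sum>j\<in>-{1::3}. g j) = g 2 + g 3" "(\<Sum>j\<in>-{2::3}. g j) = g 1 + g 3"
  "(\<Sum>j\<in>-{3::3}. g j) = g 1 + g 2"
proof -
  have "x \<in> -{1} \<longleftrightarrow> x \<in> {2, 3}" "x \<in> -{2} \<longleftrightarrow> x \<in> {1, 3}" "x \<in> -{3} \<longleftrightarrow> x \<in> {1, 2}" for x :: 3
    using exhaust_3[of x] by auto
  then have "-{1::3} = {2, 3}" "-{2::3} = {1, 3}" "-{3::3} = {1, 2}" by blast+
  then show "(\<Sum>j\<in>-{1::3}. g j) = g 2 + g 3" "(\<Sum>j\<in>-{2::3}. g j) = g 1 + g 3"
    "(\<Sum>j\<in>-{3::3}. g j) = g 1 + g 2" by simp_all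
qed

text \<open>The first entries fix the ratio in which the point divides the segment. Collinearity is
  assumed in cross-multiplied form, so that it can be checked entrywise without quotients.\<close>

lemma bracket_in_open_segment:
  assumes "(x - u) *\<^sub>R (bracket \<Gamma> v v' v'' - bracket \<Gamma> u u' u'') =
      (v - u) *\<^sub>R (bracket \<Gamma> x x' x'' - bracket \<Gamma> u u' u'')"
    and x: "u < x \<and> x < v \<or> v < x \<and> x < u"
  shows "bracket \<Gamma> x x' x'' \<in> open_segment (bracket \<Gamma> u u' u'') (bracket \<Gamma> v v' v'')"
proof -
  let ?U = "bracket \<Gamma> u u' u''" and ?V = "bracket \<Gamma> v v' v''" and ?X = "bracket \<Gamma> x x' x''"
  define r where "r = (x - u) / (v - u)"
  have r: "0 < r" "r < 1" using x by (auto simp: r_def zero_less_divide_iff divide_less_eq_1)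
  have uv: "v - u \<noteq> 0" using x by auto
  then have "(v - u) *\<^sub>R (r *\<^sub>R (?V - ?U)) = (x - u) *\<^sub>R (?V - ?U)"
    unfolding r_def scaleR_scaleR by simp
  also note assms(1)
  finally have "r *\<^sub>R (?V - ?U) = ?X - ?U" using uv by (simp only: scaleR_cancel_left simp_thms)
  then have "?X = ?U + r *\<^sub>R (?V - ?U)" by simp
  then have "?X = (1 - r) *\<^sub>R ?U + r *\<^sub>R ?V"
    by (simp add: scaleR_diff_left scaleR_diff_right)
  moreover have "?U $ 1 \<noteq> ?V $ 1" using x by auto
  then have "?U \<noteq> ?V" by metis
  ultimately show ?thesis using r by (auto simp: in_segment)
qed

text \<open>The marked points that are not vertices lie on sides from a along which the second or
  the third eigenvalue is 0. There the first entry alone determines the position.\<close>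

lemma
  assumes "u < x \<and> x < v \<or> v < x \<and> x < u"
  shows open_segment_bracket_12: "u + u' = x + x' \<Longrightarrow> v + v' = x + x' \<Longrightarrow>
      bracket \<Gamma> x x' 0 \<in> open_segment (bracket \<Gamma> u u' 0) (bracket \<Gamma> v v' 0)"
    and open_segment_bracket_13: "u + u' = x + x' \<Longrightarrow> v + v' = x + x' \<Longrightarrow>
      bracket \<Gamma> x 0 x' \<in> open_segment (bracket \<Gamma> u 0 u') (bracket \<Gamma> v 0 v')"
proof -
  assume "u + u' = x + x'" "v + v' = x + x'"
  then have e: "u' = x + x' - u" "v' = x + x' - v" by simp_all
  show "bracket \<Gamma> x x' 0 \<in> open_segment (bracket \<Gamma> u u' 0) (bracket \<Gamma> v v' 0)"
    "bracket \<Gamma> x 0 x' \<in> open_segment (bracket \<Gamma> u 0 u') (bracket \<Gamma> v 0 v')"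
    by (rule bracket_in_open_segment[OF _ assms];
        simp add: e vec_eq_iff forall_3 algebra_simps)+
qed

lemma bracket_in_trace_free [simp]: "bracket \<Gamma> x y z \<in> trace_free \<longleftrightarrow> x + y + z = total_weight \<Gamma>"
  by (auto simp: trace_free_def)

lemma inner_vector_3: "vector [p, q, r] \<bullet> (x :: real^3) = p * x $ 1 + q * x $ 2 + r * x $ 3"
  by (simp add: inner_vec_def sum_3)

section \<open>The polygon of each type\<close>

lemmas type_point_defs = pt_a_def pt_b_def pt_half_def

text \<open>The scheme for all eight types: the weight inequalities fix the decreasing order of the
  numbers in each \<open>pt_c\<close>, and \<open>fs\<close> lists the lines of the sides in cyclic
  order. With \<open>l = x + t\<close>, the sides here are \<open>l $ 3 = 0\<close>, the wall
  \<open>l $ 1 = l $ 2\<close>, \<open>l $ 1 = \<Gamma> $ 1\<close>,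
  \<open>l $ 3 = \<Gamma> $ 3\<close> and the wall \<open>l $ 2 = l $ 3\<close>.\<close>

lemma polygon_type_A:
  assumes "decreasing \<Gamma>" "0 < total_weight \<Gamma>" "type_weights Type_A \<Gamma>"
  shows "convex_polygon (type_vertices Type_A \<Gamma>) (momentum_polytope \<Gamma>)"
    and "type_marked_edges Type_A \<Gamma>"
proof -
  define t where "t = total_weight \<Gamma> / 3"
  then have tw: "total_weight \<Gamma> = 3 * t" by simp
  then have "\<Gamma> $ 1 + \<Gamma> $ 2 + \<Gamma> $ 3 = 3 * t" by (simp add: total_weight_eq)
  note ineqs = this assms[unfolded decreasing_def tw type_weights.simps]
  have c: "pt_c \<Gamma> 1 = bracket \<Gamma> (\<Gamma> $ 2 + \<Gamma> $ 3) (\<Gamma> $ 1) 0"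
    "pt_c \<Gamma> 2 = bracket \<Gamma> (\<Gamma> $ 1 + \<Gamma> $ 3) (\<Gamma> $ 2) 0"
    "pt_c \<Gamma> 3 = bracket \<Gamma> (\<Gamma> $ 1 + \<Gamma> $ 2) (\<Gamma> $ 3) 0"
    by (rule pt_c_eqI; use ineqs in \<open>simp add: sum_Compl_3 add_mset_commute\<close>)+
  show "type_marked_edges Type_A \<Gamma>"
    using ineqs by (auto simp: tw c type_point_defs
        intro!: open_segment_bracket_12 open_segment_bracket_13)
  have signs: "0 < \<Gamma> $ 3" using ineqs by simp_all
  note P = momentum_polytope_ppp[OF assms(1) signs]
  show "convex_polygon (type_vertices Type_A \<Gamma>) (momentum_polytope \<Gamma>)"
    by (rule convex_polygon_from_lines[where fs = "[(vector [0, 0, 1], - t), (vector [1, -1, 0], 0),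
          (vector [1, 0, 0], \<Gamma> $ 1 - t), (vector [0, 0, -1], t - \<Gamma> $ 3), 
          (vector [0, 1, -1], 0)]"];
        simp add: P tw c type_point_defs inner_vector_3 All_less_Suc;
        insert ineqs; (rule Collect_cong)?; (unfold trace_free_def mem_Collect_eq)?;
        (rule iffI)?; (elim conjE)?; (intro conjI)?; linarith)
qed

text \<open>Now \<open>l $ 1 \<ge> \<Gamma> $ 1 > \<Gamma> $ 2 + \<Gamma> $ 3 \<ge> l $ 2\<close>,
  so the polytope stays away from the wall \<open>l $ 1 = l $ 2\<close> and has one side less than
  in type A.\<close>

lemma polygon_type_B:
  assumes "decreasing \<Gamma>" "0 < total_weight \<Gamma>" "type_weights Type_B \<Gamma>"
  shows "convex_polygon (type_vertices Type_B \<Gamma>) (momentum_polytope \<Gamma>)"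
    and "type_marked_edges Type_B \<Gamma>"
proof -
  define t where "t = total_weight \<Gamma> / 3"
  then have tw: "total_weight \<Gamma> = 3 * t" by simp
  then have "\<Gamma> $ 1 + \<Gamma> $ 2 + \<Gamma> $ 3 = 3 * t" by (simp add: total_weight_eq)
  note ineqs = this assms[unfolded decreasing_def tw type_weights.simps]
  have c: "pt_c \<Gamma> 1 = bracket \<Gamma> (\<Gamma> $ 1) (\<Gamma> $ 2 + \<Gamma> $ 3) 0"
    "pt_c \<Gamma> 2 = bracket \<Gamma> (\<Gamma> $ 1 + \<Gamma> $ 3) (\<Gamma> $ 2) 0"
    "pt_c \<Gamma> 3 = bracket \<Gamma> (\<Gamma> $ 1 + \<Gamma> $ 2) (\<Gamma> $ 3) 0"
    by (rule pt_c_eqI; use ineqs in \<open>simp add: sum_Compl_3 add_mset_commute\<close>)+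
  show "type_marked_edges Type_B \<Gamma>"
    using ineqs by (auto simp: tw c type_point_defs
        intro!: open_segment_bracket_12 open_segment_bracket_13)
  have signs: "0 < \<Gamma> $ 3" using ineqs by simp_all
  note P = momentum_polytope_ppp[OF assms(1) signs]
  show "convex_polygon (type_vertices Type_B \<Gamma>) (momentum_polytope \<Gamma>)"
    by (rule convex_polygon_from_lines[where fs = "[(vector [0, 0, 1], - t), (vector [1, 0, 0], \<Gamma> $ 1 - t),
          (vector [0, 0, -1], t - \<Gamma> $ 3), (vector [0, 1, -1], 0)]"];
        simp add: P tw c type_point_defs inner_vector_3 All_less_Suc;
        insert ineqs; (rule Collect_cong)?; (unfold trace_free_def mem_Collect_eq)?;
        (rule iffI)?; (elim conjE)?; (intro conjI)?; linarith)
qed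

text \<open>Because of \<open>\<Gamma> $ 2 < \<Gamma> $ 1 + \<Gamma> $ 3\<close>, the line
  \<open>l $ 2 = \<Gamma> $ 2\<close> meets \<open>l $ 3 = 0\<close> before the wall
  \<open>l $ 1 = l $ 2\<close>. No side lies on a wall of the chamber.\<close>

lemma polygon_type_C:
  assumes "decreasing \<Gamma>" "0 < total_weight \<Gamma>" "type_weights Type_C \<Gamma>"
  shows "convex_polygon (type_vertices Type_C \<Gamma>) (momentum_polytope \<Gamma>)"
    and "type_marked_edges Type_C \<Gamma>"
proof -
  define t where "t = total_weight \<Gamma> / 3"
  then have tw: "total_weight \<Gamma> = 3 * t" by simp
  then have "\<Gamma> $ 1 + \<Gamma> $ 2 + \<Gamma> $ 3 = 3 * t" by (simp add: total_weight_eq)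
  note ineqs = this assms[unfolded decreasing_def tw type_weights.simps]
  have c: "pt_c \<Gamma> 1 = bracket \<Gamma> (\<Gamma> $ 1) (\<Gamma> $ 2 + \<Gamma> $ 3) 0"
    "pt_c \<Gamma> 2 = bracket \<Gamma> (\<Gamma> $ 1 + \<Gamma> $ 3) (\<Gamma> $ 2) 0"
    "pt_c \<Gamma> 3 = bracket \<Gamma> (\<Gamma> $ 1 + \<Gamma> $ 2) 0 (\<Gamma> $ 3)"
    by (rule pt_c_eqI; use ineqs in \<open>simp add: sum_Compl_3 add_mset_commute\<close>)+
  show "type_marked_edges Type_C \<Gamma>"
    using ineqs by (auto simp: tw c type_point_defs
        intro!: open_segment_bracket_12 open_segment_bracket_13)
  have signs: "0 < \<Gamma> $ 2" "\<Gamma> $ 3 < 0" using ineqs by simp_all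
  note P = momentum_polytope_ppn[OF assms(1) signs]
  show "convex_polygon (type_vertices Type_C \<Gamma>) (momentum_polytope \<Gamma>)"
    by (rule convex_polygon_from_lines[where fs = "[(vector [0, 1, 0], - t), (vector [0, 0, 1], \<Gamma> $ 3 - t),
          (vector [0, -1, 0], t - \<Gamma> $ 2), (vector [0, 0, -1], t)]"];
        simp add: P tw c type_point_defs inner_vector_3 All_less_Suc;
        insert ineqs; (rule Collect_cong)?; (unfold trace_free_def mem_Collect_eq)?;
        (rule iffI)?; (elim conjE)?; (intro conjI)?; linarith)
qed

text \<open>The sides are \<open>l $ 2 = 0\<close>, \<open>l $ 1 = \<Gamma> $ 1\<close>,
  \<open>l $ 2 = \<Gamma> $ 2\<close> and the wall \<open>l $ 2 = l $ 3\<close>. All three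
  \<open>pt_c\<close> have middle eigenvalue 0 and so lie on the first side.\<close>

lemma polygon_type_D:
  assumes "decreasing \<Gamma>" "0 < total_weight \<Gamma>" "type_weights Type_D \<Gamma>"
  shows "convex_polygon (type_vertices Type_D \<Gamma>) (momentum_polytope \<Gamma>)"
    and "type_marked_edges Type_D \<Gamma>"
proof -
  define t where "t = total_weight \<Gamma> / 3"
  then have tw: "total_weight \<Gamma> = 3 * t" by simp
  then have "\<Gamma> $ 1 + \<Gamma> $ 2 + \<Gamma> $ 3 = 3 * t" by (simp add: total_weight_eq)
  note ineqs = this assms[unfolded decreasing_def tw type_weights.simps]
  have c: "pt_c \<Gamma> 1 = bracket \<Gamma> (\<Gamma> $ 1) 0 (\<Gamma> $ 2 + \<Gamma> $ 3)"
    "pt_c \<Gamma> 2 = bracket \<Gamma> (\<Gamma> $ 1 + \<Gamma> $ 3) 0 (\<Gamma> $ 2)"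
    "pt_c \<Gamma> 3 = bracket \<Gamma> (\<Gamma> $ 1 + \<Gamma> $ 2) 0 (\<Gamma> $ 3)"
    by (rule pt_c_eqI; use ineqs in \<open>simp add: sum_Compl_3 add_mset_commute\<close>)+
  show "type_marked_edges Type_D \<Gamma>"
    using ineqs by (auto simp: tw c type_point_defs
        intro!: open_segment_bracket_12 open_segment_bracket_13)
  have signs: "\<Gamma> $ 2 < 0" using ineqs by simp_all
  note P = momentum_polytope_pnn[OF assms(1) signs assms(2)]
  show "convex_polygon (type_vertices Type_D \<Gamma>) (momentum_polytope \<Gamma>)"
    by (rule convex_polygon_from_lines[where fs = "[(vector [0, -1, 0], t), (vector [-1, 0, 0], t - \<Gamma> $ 1),
          (vector [0, 1, 0], \<Gamma> $ 2 - t), (vector [0, 1, -1], 0)]"];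
        simp add: P tw c type_point_defs inner_vector_3 All_less_Suc;
        insert ineqs; (rule Collect_cong)?; (unfold trace_free_def mem_Collect_eq)?;
        (rule iffI)?; (elim conjE)?; (intro conjI)?; linarith)
qed

text \<open>The lines are those of type C. The sign of \<open>\<Gamma> $ 2 + \<Gamma> $ 3\<close>
  moves \<open>pt_c \<Gamma> 1\<close> from the side \<open>l $ 3 = 0\<close> to the side
  \<open>l $ 2 = 0\<close>.\<close>

lemma polygon_type_E:
  assumes "decreasing \<Gamma>" "0 < total_weight \<Gamma>" "type_weights Type_E \<Gamma>"
  shows "convex_polygon (type_vertices Type_E \<Gamma>) (momentum_polytope \<Gamma>)"
    and "type_marked_edges Type_E \<Gamma>"
proof -
  define t where "t = total_weight \<Gamma> / 3"
  then have tw: "total_weight \<Gamma> = 3 * t" by simp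
  then have "\<Gamma> $ 1 + \<Gamma> $ 2 + \<Gamma> $ 3 = 3 * t" by (simp add: total_weight_eq)
  note ineqs = this assms[unfolded decreasing_def tw type_weights.simps]
  have c: "pt_c \<Gamma> 1 = bracket \<Gamma> (\<Gamma> $ 1) 0 (\<Gamma> $ 2 + \<Gamma> $ 3)"
    "pt_c \<Gamma> 2 = bracket \<Gamma> (\<Gamma> $ 1 + \<Gamma> $ 3) (\<Gamma> $ 2) 0"
    "pt_c \<Gamma> 3 = bracket \<Gamma> (\<Gamma> $ 1 + \<Gamma> $ 2) 0 (\<Gamma> $ 3)"
    by (rule pt_c_eqI; use ineqs in \<open>simp add: sum_Compl_3 add_mset_commute\<close>)+
  show "type_marked_edges Type_E \<Gamma>"
    using ineqs by (auto simp: tw c type_point_defs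
        intro!: open_segment_bracket_12 open_segment_bracket_13)
  have signs: "0 < \<Gamma> $ 2" "\<Gamma> $ 3 < 0" using ineqs by simp_all
  note P = momentum_polytope_ppn[OF assms(1) signs]
  show "convex_polygon (type_vertices Type_E \<Gamma>) (momentum_polytope \<Gamma>)"
    by (rule convex_polygon_from_lines[where fs = "[(vector [0, 1, 0], - t), (vector [0, 0, 1], \<Gamma> $ 3 - t),
          (vector [0, -1, 0], t - \<Gamma> $ 2), (vector [0, 0, -1], t)]"];
        simp add: P tw c type_point_defs inner_vector_3 All_less_Suc;
        insert ineqs; (rule Collect_cong)?; (unfold trace_free_def mem_Collect_eq)?;
        (rule iffI)?; (elim conjE)?; (intro conjI)?; linarith)
qed

text \<open>Because of \<open>\<Gamma> $ 2 > \<Gamma> $ 1 + \<Gamma> $ 3\<close>, the side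
  \<open>l $ 2 = \<Gamma> $ 2\<close> ends on the wall \<open>l $ 1 = l $ 2\<close>, which becomes a
  fifth side. Types G and H have the same lines and differ in the positions of
  \<open>pt_c \<Gamma> 1\<close> and \<open>pt_c \<Gamma> 2\<close>.\<close>

lemma polygon_type_F:
  assumes "decreasing \<Gamma>" "0 < total_weight \<Gamma>" "type_weights Type_F \<Gamma>"
  shows "convex_polygon (type_vertices Type_F \<Gamma>) (momentum_polytope \<Gamma>)"
    and "type_marked_edges Type_F \<Gamma>"
proof -
  define t where "t = total_weight \<Gamma> / 3"
  then have tw: "total_weight \<Gamma> = 3 * t" by simp
  then have "\<Gamma> $ 1 + \<Gamma> $ 2 + \<Gamma> $ 3 = 3 * t" by (simp add: total_weight_eq)
  note ineqs = this assms[unfolded decreasing_def tw type_weights.simps]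
  have c: "pt_c \<Gamma> 1 = bracket \<Gamma> (\<Gamma> $ 1) 0 (\<Gamma> $ 2 + \<Gamma> $ 3)"
    "pt_c \<Gamma> 2 = bracket \<Gamma> (\<Gamma> $ 2) (\<Gamma> $ 1 + \<Gamma> $ 3) 0"
    "pt_c \<Gamma> 3 = bracket \<Gamma> (\<Gamma> $ 1 + \<Gamma> $ 2) 0 (\<Gamma> $ 3)"
    by (rule pt_c_eqI; use ineqs in \<open>simp add: sum_Compl_3 add_mset_commute\<close>)+
  show "type_marked_edges Type_F \<Gamma>"
    using ineqs by (auto simp: tw c type_point_defs
        intro!: open_segment_bracket_12 open_segment_bracket_13)
  have signs: "0 < \<Gamma> $ 2" "\<Gamma> $ 3 < 0" using ineqs by simp_all
  note P = momentum_polytope_ppn[OF assms(1) signs]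
  show "convex_polygon (type_vertices Type_F \<Gamma>) (momentum_polytope \<Gamma>)"
    by (rule convex_polygon_from_lines[where fs = "[(vector [0, 1, 0], - t), (vector [0, 0, 1], \<Gamma> $ 3 - t),
          (vector [0, -1, 0], t - \<Gamma> $ 2), (vector [1, -1, 0], 0), 
          (vector [0, 0, -1], t)]"];
        simp add: P tw c type_point_defs inner_vector_3 All_less_Suc;
        insert ineqs; (rule Collect_cong)?; (unfold trace_free_def mem_Collect_eq)?;
        (rule iffI)?; (elim conjE)?; (intro conjI)?; linarith)
qed

lemma polygon_type_G:
  assumes "decreasing \<Gamma>" "0 < total_weight \<Gamma>" "type_weights Type_G \<Gamma>"
  shows "convex_polygon (type_vertices Type_G \<Gamma>) (momentum_polytope \<Gamma>)"
    and "type_marked_edges Type_G \<Gamma>"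
proof -
  define t where "t = total_weight \<Gamma> / 3"
  then have tw: "total_weight \<Gamma> = 3 * t" by simp
  then have "\<Gamma> $ 1 + \<Gamma> $ 2 + \<Gamma> $ 3 = 3 * t" by (simp add: total_weight_eq)
  note ineqs = this assms[unfolded decreasing_def tw type_weights.simps]
  have c: "pt_c \<Gamma> 1 = bracket \<Gamma> (\<Gamma> $ 1) 0 (\<Gamma> $ 2 + \<Gamma> $ 3)"
    "pt_c \<Gamma> 2 = bracket \<Gamma> (\<Gamma> $ 2) 0 (\<Gamma> $ 1 + \<Gamma> $ 3)"
    "pt_c \<Gamma> 3 = bracket \<Gamma> (\<Gamma> $ 1 + \<Gamma> $ 2) 0 (\<Gamma> $ 3)"
    by (rule pt_c_eqI; use ineqs in \<open>simp add: sum_Compl_3 add_mset_commute\<close>)+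
  show "type_marked_edges Type_G \<Gamma>"
    using ineqs by (auto simp: tw c type_point_defs
        intro!: open_segment_bracket_12 open_segment_bracket_13)
  have signs: "0 < \<Gamma> $ 2" "\<Gamma> $ 3 < 0" using ineqs by simp_all
  note P = momentum_polytope_ppn[OF assms(1) signs]
  show "convex_polygon (type_vertices Type_G \<Gamma>) (momentum_polytope \<Gamma>)"
    by (rule convex_polygon_from_lines[where fs = "[(vector [0, 1, 0], - t), (vector [0, 0, 1], \<Gamma> $ 3 - t),
          (vector [0, -1, 0], t - \<Gamma> $ 2), (vector [1, -1, 0], 0), 
          (vector [0, 0, -1], t)]"];
        simp add: P tw c type_point_defs inner_vector_3 All_less_Suc;
        insert ineqs; (rule Collect_cong)?; (unfold trace_free_def mem_Collect_eq)?;
        (rule iffI)?; (elim conjE)?; (intro conjI)?; linarith)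
qed

lemma polygon_type_H:
  assumes "decreasing \<Gamma>" "0 < total_weight \<Gamma>" "type_weights Type_H \<Gamma>"
  shows "convex_polygon (type_vertices Type_H \<Gamma>) (momentum_polytope \<Gamma>)"
    and "type_marked_edges Type_H \<Gamma>"
proof -
  define t where "t = total_weight \<Gamma> / 3"
  then have tw: "total_weight \<Gamma> = 3 * t" by simp
  then have "\<Gamma> $ 1 + \<Gamma> $ 2 + \<Gamma> $ 3 = 3 * t" by (simp add: total_weight_eq)
  note ineqs = this assms[unfolded decreasing_def tw type_weights.simps]
  have c: "pt_c \<Gamma> 1 = bracket \<Gamma> (\<Gamma> $ 1) (\<Gamma> $ 2 + \<Gamma> $ 3) 0"
    "pt_c \<Gamma> 2 = bracket \<Gamma> (\<Gamma> $ 2) (\<Gamma> $ 1 + \<Gamma> $ 3) 0"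
    "pt_c \<Gamma> 3 = bracket \<Gamma> (\<Gamma> $ 1 + \<Gamma> $ 2) 0 (\<Gamma> $ 3)"
    by (rule pt_c_eqI; use ineqs in \<open>simp add: sum_Compl_3 add_mset_commute\<close>)+
  show "type_marked_edges Type_H \<Gamma>"
    using ineqs by (auto simp: tw c type_point_defs
        intro!: open_segment_bracket_12 open_segment_bracket_13)
  have signs: "0 < \<Gamma> $ 2" "\<Gamma> $ 3 < 0" using ineqs by simp_all
  note P = momentum_polytope_ppn[OF assms(1) signs]
  show "convex_polygon (type_vertices Type_H \<Gamma>) (momentum_polytope \<Gamma>)"
    by (rule convex_polygon_from_lines[where fs = "[(vector [0, 1, 0], - t), (vector [0, 0, 1], \<Gamma> $ 3 - t),
          (vector [0, -1, 0], t - \<Gamma> $ 2), (vector [1, -1, 0], 0), 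
          (vector [0, 0, -1], t)]"];
        simp add: P tw c type_point_defs inner_vector_3 All_less_Suc;
        insert ineqs; (rule Collect_cong)?; (unfold trace_free_def mem_Collect_eq)?;
        (rule iffI)?; (elim conjE)?; (intro conjI)?; linarith)
qed

lemma polygon_of_type:
  assumes "decreasing \<Gamma>" "0 < total_weight \<Gamma>" "type_weights T \<Gamma>"
  shows "convex_polygon (type_vertices T \<Gamma>) (momentum_polytope \<Gamma>) \<and> type_marked_edges T \<Gamma>"
  using assms
  by (cases T) (simp_all only: polygon_type_A polygon_type_B polygon_type_C polygon_type_D
    polygon_type_E polygon_type_F polygon_type_G polygon_type_H simp_thms)

section \<open>Relabelling of the weights and the case distinction\<close>

lemma total_weight_relabel: "bij \<sigma> \<Longrightarrow> total_weight (relabel \<sigma> \<Gamma>) = total_weight \<Gamma>"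
  unfolding total_weight_def relabel_def vec_lambda_beta by (rule sum.reindex_bij_betw)

text \<open>The vectors are permuted along with the weights.\<close>

lemma realizable_spectrum_relabel:
  assumes "bij \<sigma>" "realizable_spectrum \<Gamma> l"
  shows "realizable_spectrum (relabel \<sigma> \<Gamma>) l"
proof -
  obtain Z where Z: "\<And>j. norm (Z $ j) = 1" "(\<Sum>j\<in>UNIV. \<Gamma> $ j *\<^sub>R outer (Z $ j)) = diag_matrix l"
    using assms(2) by (auto simp: realizable_spectrum_def)
  have "(\<Sum>j\<in>UNIV. \<Gamma> $ \<sigma> j *\<^sub>R outer (Z $ \<sigma> j)) = diag_matrix l"
    unfolding Z(2)[symmetric] by (rule sum.reindex_bij_betw[OF assms(1)])
  then show ?thesis unfolding realizable_spectrum_def relabel_def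
    by (intro exI[of _ "\<chi> j. Z $ \<sigma> j"]) (simp add: Z(1))
qed

lemma momentum_polytope_relabel:
  assumes "bij \<sigma>"
  shows "momentum_polytope (relabel \<sigma> \<Gamma>) = momentum_polytope \<Gamma>"
proof -
  have "relabel (inv \<sigma>) (relabel \<sigma> \<Gamma>) = \<Gamma>"
    using assms by (simp add: relabel_def vec_eq_iff bij_is_surj surj_f_inv_f)
  then have "realizable_spectrum (relabel \<sigma> \<Gamma>) l \<longleftrightarrow> realizable_spectrum \<Gamma> l" for l
    using realizable_spectrum_relabel[OF assms] realizable_spectrum_relabel[OF bij_imp_bij_inv[OF assms]]
    by metis
  then show ?thesis by (simp add: momentum_polytope_eq total_weight_relabel[OF assms])
qed

lemma admissible_relabel:
  assumes "bij \<sigma>" "admissible \<Gamma>"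
  shows "admissible (relabel \<sigma> \<Gamma>)"
proof -
  have [simp]: "\<sigma> i = \<sigma> j \<longleftrightarrow> i = j" for i j using assms(1) by (simp add: bij_is_inj inj_eq)
  show ?thesis
    using assms(2) unfolding admissible_def total_weight_relabel[OF assms(1)]
    by (simp add: relabel_def)
qed

lemma ex1_decreasing_relabel:
  assumes "admissible \<Gamma>"
  shows "\<exists>!\<sigma>. bij \<sigma> \<and> decreasing (relabel \<sigma> \<Gamma>)"
proof -
  have inj: "\<Gamma> $ i = \<Gamma> $ j \<Longrightarrow> i = j" for i j
    using assms by (auto simp: admissible_def)
  have ne: "\<Gamma> $ 1 \<noteq> \<Gamma> $ 2" "\<Gamma> $ 1 \<noteq> \<Gamma> $ 3" "\<Gamma> $ 2 \<noteq> \<Gamma> $ 3" by (auto dest: inj)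
  then have "\<exists>a b c. \<Gamma> $ a > \<Gamma> $ b \<and> \<Gamma> $ b > \<Gamma> $ c"
    by (metis linorder_neqE)
  then obtain a b c where abc: "\<Gamma> $ a > \<Gamma> $ b" "\<Gamma> $ b > \<Gamma> $ c" by blast
  define \<sigma> where "\<sigma> j = (if j = 1 then a else if j = 2 then b else c)" for j :: 3
  have "distinct [a, b, c]" using abc by auto
  then have "inj \<sigma>"
    by (auto simp: inj_def \<sigma>_def split: if_splits) (metis exhaust_3)
  then have "bij \<sigma>" by (simp add: bij_def finite_UNIV_inj_surj)
  moreover have "decreasing (relabel \<sigma> \<Gamma>)" using abc by (simp add: decreasing_def relabel_def \<sigma>_def)
  moreover have "\<tau> = \<rho>" if \<tau>: "bij \<tau>" "decreasing (relabel \<tau> \<Gamma>)"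
    and \<rho>: "bij \<rho>" "decreasing (relabel \<rho> \<Gamma>)" for \<tau> \<rho>
  proof -
    \<comment> \<open>A decreasing relabelling sends 1 to the index of the largest weight and 3 to
      that of the smallest; the value at 2 is what remains.\<close>
    have ext: "\<Gamma> $ i \<le> \<Gamma> $ \<phi> 1 \<and> \<Gamma> $ \<phi> 3 \<le> \<Gamma> $ i"
      if "bij \<phi>" "decreasing (relabel \<phi> \<Gamma>)" for \<phi> i
    proof -
      obtain j where "i = \<phi> j" using \<open>bij \<phi>\<close> by (metis bij_pointE)
      then show ?thesis
        using that(2) exhaust_3[of j] by (auto simp: decreasing_def relabel_def)
    qed
    have 1: "\<tau> 1 = \<rho> 1" and 3: "\<tau> 3 = \<rho> 3"
      using ext[OF \<tau>] ext[OF \<rho>] by (auto intro!: inj antisym)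
    have 2: "\<tau> 2 = \<rho> 2"
    proof -
      obtain j where j: "\<tau> 2 = \<rho> j" using \<open>bij \<rho>\<close> by (metis bij_pointE)
      moreover have "\<tau> 2 \<noteq> \<tau> 1" "\<tau> 2 \<noteq> \<tau> 3" using \<tau>(1) by (simp_all add: bij_is_inj inj_eq)
      ultimately show ?thesis using 1 3 exhaust_3[of j] by auto
    qed
    show ?thesis
    proof
      fix j show "\<tau> j = \<rho> j" using 1 2 3 exhaust_3[of j] by auto
    qed
  qed
  ultimately show ?thesis by blast
qed

text \<open>After the signs of the last two weights, the comparison of \<open>\<Gamma> $ 1\<close>
  with \<open>\<Gamma> $ 2 + \<Gamma> $ 3\<close> separates A from B. In the pattern
  \<open>++-\<close>, the comparison of \<open>\<Gamma> $ 2\<close> with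
  \<open>\<Gamma> $ 1 + \<Gamma> $ 3\<close> separates C, E from F, G, H. Since
  \<open>\<Gamma> $ 2 + \<Gamma> $ 3 < \<Gamma> $ 1 + \<Gamma> $ 3\<close>, the signs of these two
  sums allow three combinations: both positive (C, H), mixed (E, F), both negative (G).\<close>

lemma ex1_type_weights:
  assumes "admissible \<Gamma>" "decreasing \<Gamma>"
  shows "\<exists>!T. type_weights T \<Gamma>"
proof -
  have adm: "\<Gamma> $ 2 \<noteq> 0" "\<Gamma> $ 3 \<noteq> 0" "\<Gamma> $ 1 + \<Gamma> $ 3 \<noteq> 0" "\<Gamma> $ 2 + \<Gamma> $ 3 \<noteq> 0"
      "0 < \<Gamma> $ 1 + \<Gamma> $ 2 + \<Gamma> $ 3"
    using assms(1) by (auto simp: admissible_def total_weight_eq)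
  have "\<Gamma> $ i - \<Gamma> $ j - \<Gamma> $ k \<noteq> 0" if "distinct [i, j, k]" for i j k
    using assms(1) that unfolding admissible_def by blast
  from this[of 1 2 3] this[of 2 1 3]
  have ne: "\<Gamma> $ 1 \<noteq> \<Gamma> $ 2 + \<Gamma> $ 3" "\<Gamma> $ 2 \<noteq> \<Gamma> $ 1 + \<Gamma> $ 3" by auto
  note dec = assms(2)[unfolded decreasing_def]
  have "\<exists>T. type_weights T \<Gamma>"
  proof (rule ccontr)
    assume "\<nexists>T. type_weights T \<Gamma>"
    then have "\<not> type_weights T \<Gamma>" for T by blast
    from this[of Type_A] this[of Type_B] this[of Type_C] this[of Type_D]
      this[of Type_E] this[of Type_F] this[of Type_G] this[of Type_H]
    show False using adm ne dec unfolding type_weights.simps by (smt (verit))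
  qed
  moreover have "T = T'" if "type_weights T \<Gamma>" "type_weights T' \<Gamma>" for T T'
    using that dec by (cases T; cases T'; simp)
  ultimately show ?thesis by blast
qed

text \<open>Explicit integer weights show that no item of the list is vacuous, so there are eight
  types and not fewer.\<close>

lemma type_weights_witness:
  "\<exists>\<Gamma>. admissible \<Gamma> \<and> decreasing \<Gamma> \<and> type_weights T \<Gamma>"
proof (cases T)
  case Type_A
  then show ?thesis
    by (intro exI[of _ "vector [4, 3, 2]"]) (simp add: admissible_def total_weight_eq forall_3 decreasing_def)
next
  case Type_B
  then show ?thesis
    by (intro exI[of _ "vector [5, 2, 1]"]) (simp add: admissible_def total_weight_eq forall_3 decreasing_def)
next
  case Type_C
  then show ?thesis
    by (intro exI[of _ "vector [5, 2, -1]"]) (simp add: admissible_def total_weight_eq forall_3 decreasing_def)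
next
  case Type_D
  then show ?thesis
    by (intro exI[of _ "vector [5, -1, -2]"]) (simp add: admissible_def total_weight_eq forall_3 decreasing_def)
next
  case Type_E
  then show ?thesis
    by (intro exI[of _ "vector [5, 1, -2]"]) (simp add: admissible_def total_weight_eq forall_3 decreasing_def)
next
  case Type_F
  then show ?thesis
    by (intro exI[of _ "vector [4, 2, -3]"]) (simp add: admissible_def total_weight_eq forall_3 decreasing_def)
next
  case Type_G
  then show ?thesis
    by (intro exI[of _ "vector [4, 3, -5]"]) (simp add: admissible_def total_weight_eq forall_3 decreasing_def)
next
  case Type_H
  then show ?thesis
    by (intro exI[of _ "vector [4, 3, -2]"]) (simp add: admissible_def total_weight_eq forall_3 decreasing_def)
qed

theorem theorem4p1:
  fixes \<Gamma> :: "real^3"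
  assumes "admissible \<Gamma>"
  shows "(\<forall>\<sigma>. bij \<sigma> \<longrightarrow> momentum_polytope (relabel \<sigma> \<Gamma>) = momentum_polytope \<Gamma>) \<and>
    (\<exists>!\<sigma>. bij \<sigma> \<and> decreasing (relabel \<sigma> \<Gamma>)) \<and>
    (\<forall>\<sigma> \<gamma>. bij \<sigma> \<and> \<gamma> = relabel \<sigma> \<Gamma> \<and> decreasing \<gamma> \<longrightarrow>
       (\<exists>!T. type_weights T \<gamma>) \<and>
       (\<forall>T. type_weights T \<gamma> \<longrightarrow>
          convex_polygon (type_vertices T \<gamma>) (momentum_polytope \<Gamma>) \<and>
          type_marked_edges T \<gamma>)) \<and>
    (\<forall>T. \<exists>\<Gamma>'. admissible \<Gamma>' \<and> decreasing \<Gamma>' \<and> type_weights T \<Gamma>')"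
proof (intro conjI allI impI)
  show "momentum_polytope (relabel \<sigma> \<Gamma>) = momentum_polytope \<Gamma>" if "bij \<sigma>" for \<sigma>
    using that by (rule momentum_polytope_relabel)
  show "\<exists>!\<sigma>. bij \<sigma> \<and> decreasing (relabel \<sigma> \<Gamma>)"
    using assms by (rule ex1_decreasing_relabel)
  show "\<exists>\<Gamma>'. admissible \<Gamma>' \<and> decreasing \<Gamma>' \<and> type_weights T \<Gamma>'" for T
    by (rule type_weights_witness)
  fix \<sigma> \<gamma> assume \<gamma>: "bij \<sigma> \<and> \<gamma> = relabel \<sigma> \<Gamma> \<and> decreasing \<gamma>"
  then have adm: "admissible \<gamma>" and P: "momentum_polytope \<gamma> = momentum_polytope \<Gamma>"
    using assms admissible_relabel momentum_polytope_relabel by auto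
  show "\<exists>!T. type_weights T \<gamma>" using ex1_type_weights adm \<gamma> by blast
  fix T assume "type_weights T \<gamma>"
  moreover have "decreasing \<gamma>" "0 < total_weight \<gamma>" using adm \<gamma> by (auto simp: admissible_def)
  ultimately show "convex_polygon (type_vertices T \<gamma>) (momentum_polytope \<Gamma>)" "type_marked_edges T \<gamma>"
    using polygon_of_type[of \<gamma> T, unfolded P] by blast+
qed

end
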